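(* Let $0<c<1$ and $c'=\frac{1}{2}\log(1-c)+\frac{c}{2}+\frac{c^2}{4}+\frac{c^4}{8}$. Then $$\lim_{n\to\infty}\Pr[M(n,c,3)=-1]=1-e^{c'}\quad\text{and}\quad\lim_{n\to\infty}\Pr[M(n,c,3)=0]=e^{c'}.$$
   Context: $G(n,p)$ is the Erdős–Rényi random graph on $n$ vertices with each edge present independently with probability $p$; $K_3$ is the triangle; $\log$ is the natural logarithm. For graphs $G,H$, $\mathrm{Hom}(G,H)$ is the polyhedral complex whose cells are functions $\eta:V(G)\to 2^{V(H)}\setminus\{\varnothing\}$ with $\eta(x)\times\eta(y)\subseteq E(H)$ whenever $\{x,y\}\in E(G)$; the cell $\eta$ is a product of simplices of dimension $\sum_v(|\eta(v)|-1)$, with face relation $\eta\subseteq\tau$ iff $\eta(v)\subseteq\tau(v)$. For a space $X$, $\mathrm{conn}(X)$ is the largest $j$ such that $X$ is $j$-connected, where $X$ is $j$-connected if it is nonempty (for $j\ge-1$) and $\pi_i(X)$ vanishes for $0\le i\le j$; thus a nonempty disconnected space has $\mathrm{conn}=-1$ and a path-connected space with nontrivial $\pi_1$ has $\mathrm{conn}=0$. $M(n,c,m):=\mathrm{conn}[\mathrm{Hom}(G(n,c/n),K_m)]$. *)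

theory Defs
  imports "HOL-Analysis.Analysis"
begin

definition all_pairs :: "nat \<Rightarrow> nat set set" where
  "all_pairs n = {{x, y} | x y. x < n \<and> y < n \<and> x \<noteq> y}"

definition gnp_prob :: "nat \<Rightarrow> real \<Rightarrow> (nat set set \<Rightarrow> bool) \<Rightarrow> real" where
  "gnp_prob n p P = (\<Sum>E\<in>Pow (all_pairs n).
      if P E then p ^ card E * (1 - p) ^ (card (all_pairs n) - card E) else 0)"

text \<open>Geometric realization of Hom(G,H) for G with vertices {0..<n} and edges E,
  H with vertices VH and edges EH: the subspace of the product of simplices
  prod_{v<n} Delta^{VH} consisting of the points whose support function
  v |-> {i. f(v,i) > 0} is a cell of Hom(G,H).\<close>
definition hom_set :: "nat \<Rightarrow> nat set set \<Rightarrow> nat set \<Rightarrow> nat set set \<Rightarrow> (nat \<times> nat \<Rightarrow> real) set" where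
  "hom_set n E VH EH = {f.
      (\<forall>v i. 0 \<le> f (v, i)) \<and>
      (\<forall>v i. (n \<le> v \<or> i \<notin> VH) \<longrightarrow> f (v, i) = 0) \<and>
      (\<forall>v<n. (\<Sum>i\<in>VH. f (v, i)) = 1) \<and>
      (\<forall>x y i j. {x, y} \<in> E \<and> 0 < f (x, i) \<and> 0 < f (y, j) \<longrightarrow> {i, j} \<in> EH)}"

definition hom_top :: "nat \<Rightarrow> nat set set \<Rightarrow> nat set \<Rightarrow> nat set set \<Rightarrow> (nat \<times> nat \<Rightarrow> real) topology" where
  "hom_top n E VH EH = subtopology (product_topology (\<lambda>_. euclideanreal) UNIV) (hom_set n E VH EH)"

definition K3_V :: "nat set" where "K3_V = {0, 1, 2}"
definition K3_E :: "nat set set" where "K3_E = all_pairs 3"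

text \<open>Simply connected topological space (every loop is null-homotopic as a free loop,
  mirroring the library's simply_connected for sets).\<close>
definition simply_connected_space :: "'a topology \<Rightarrow> bool" where
  "simply_connected_space X \<longleftrightarrow> path_connected_space X \<and>
     (\<forall>p. pathin X p \<and> p 1 = p 0 \<longrightarrow>
        homotopic_with (\<lambda>r. r 1 = r 0) (top_of_set {0..1}) X p (\<lambda>_. p 0))"

text \<open>conn(X) = -1: nonempty but not 0-connected (not path-connected).
  conn(X) = 0: 0-connected but not 1-connected (pi_1 nontrivial).\<close>
definition conn_eq_minus1 :: "'a topology \<Rightarrow> bool" where
  "conn_eq_minus1 X \<longleftrightarrow> topspace X \<noteq> {} \<and> \<not> path_connected_space X"

definition conn_eq_0 :: "'a topology \<Rightarrow> bool" where
  "conn_eq_0 X \<longleftrightarrow> topspace X \<noteq> {} \<and> path_connected_space X \<and> \<not> simply_connected_space X"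

end

(* With p = c/n and c < 1, the expected number of bicyclic subgraphs (a path with a chord at either
   end) is O(1/n), so all cycles of the graph G may be taken to be disjoint and chordless. If every
   cycle then has length 4, G can be dismantled by repeatedly removing a vertex of degree at most one
   or a vertex whose neighbourhood lies in that of another vertex; recolouring moves lift along this
   dismantling, so Hom(G, K_3) is path-connected. Dismantling also shows that G is bipartite, and as
   soon as G has an edge the circle (a hexagon Hom(K_2, K_3)) is a retract of Hom(G, K_3), which is
   therefore not simply connected. If on the other hand G has a cycle C of length other than 4, some
   3-colouring of C has nonzero winding number; it extends to G, and as the winding number along C is
   locally constant on Hom(G, K_3) and changes sign when two colours are exchanged, the space is
   disconnected. Finally, Harris' and Janson's inequalities show that the probability of having no
   cycle of length other than 4 tends to exp (- sum of c^k / (2k) over k >= 3, k distinct from 4). *)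

theory Submission
  imports Defs
begin

section \<open>Product measures on power sets\<close>

text \<open>Length 4 is exceptional because the turns of a properly 3-coloured cycle of length k are
  k signs whose sum is a multiple of 3: for k = 4 only 0 is possible, while every other k >= 3
  admits a nonzero sum. In c' the terms c/2, c^2/4 and c^4/8 cancel from the series of log(1-c)/2
  the lengths 1 and 2, which no cycle has, and 4. Only the probability of having no bad cycle is
  wanted, so two one-sided inequalities replace a full Poisson limit. Harris' inequality has no
  error term and treats all lengths up to n at once. The error term of Janson's inequality is small
  only for lengths bounded by a fixed K, so K grows after n has gone to infinity. Graphs without
  edges must be discarded separately: for them Hom is a product of simplices, hence contractible. On
  the topological side explicit maps suffice: straight segments inside cells for paths, and
  coordinates on the hexagon for the loop.\<close>

definition bexp :: "'a set \<Rightarrow> real \<Rightarrow> ('a set \<Rightarrow> real) \<Rightarrow> real" where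
  "bexp S p f = (\<Sum>A\<in>Pow S. p ^ card A * (1 - p) ^ (card S - card A) * f A)"

lemma bexp_empty [simp]: "bexp {} p f = f {}"
  by (simp add: bexp_def)

text \<open>\<open>bexp S p f\<close> is the expectation of \<open>f\<close> at a random subset of S
  containing each point independently with probability p. Conditioning on whether x is chosen drives
  every induction on S below.\<close>

lemma bexp_insert:
  assumes "finite S" "x \<notin> S"
  shows "bexp (insert x S) p f = p * bexp S p (\<lambda>A. f (insert x A)) + (1 - p) * bexp S p f"
proof -
  have fin: "finite A" and nin: "x \<notin> A" and le: "card A \<le> card S" if "A \<in> Pow S" for A
    using that assms by (auto intro: finite_subset card_mono)
  have inj: "inj_on (insert x) (Pow S)"
    using assms by (auto simp: inj_on_def)
  have "bexp (insert x S) p f =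
      (\<Sum>A\<in>Pow S. p ^ card A * (1 - p) ^ (Suc (card S) - card A) * f A) +
      (\<Sum>A\<in>Pow S. p ^ card (insert x A) * (1 - p) ^ (Suc (card S) - card (insert x A)) * f (insert x A))"
    unfolding bexp_def Pow_insert using assms
    by (subst sum.union_disjoint) (auto simp: sum.reindex inj)
  also have "(\<Sum>A\<in>Pow S. p ^ card A * (1 - p) ^ (Suc (card S) - card A) * f A) = (1 - p) * bexp S p f"
    unfolding bexp_def sum_distrib_left
    by (rule sum.cong) (auto simp: Suc_diff_le le)
  also have "(\<Sum>A\<in>Pow S. p ^ card (insert x A) * (1 - p) ^ (Suc (card S) - card (insert x A)) * f (insert x A))
      = p * bexp S p (\<lambda>A. f (insert x A))"
    unfolding bexp_def sum_distrib_left
    by (rule sum.cong) (auto simp: fin nin)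
  finally show ?thesis by simp
qed

lemma bexp_add: "bexp S p (\<lambda>A. f A + g A) = bexp S p f + bexp S p g"
  by (simp add: bexp_def distrib_left sum.distrib)

lemma bexp_diff: "bexp S p (\<lambda>A. f A - g A) = bexp S p f - bexp S p g"
  by (simp add: bexp_def right_diff_distrib sum_subtractf)

lemma bexp_uminus: "bexp S p (\<lambda>A. - f A) = - bexp S p f"
  by (simp add: bexp_def sum_negf)

lemma bexp_cmult: "bexp S p (\<lambda>A. c * f A) = c * bexp S p f"
  by (simp add: bexp_def sum_distrib_left algebra_simps)

lemma bexp_sum: "bexp S p (\<lambda>A. \<Sum>i\<in>I. f i A) = (\<Sum>i\<in>I. bexp S p (f i))"
  unfolding bexp_def by (subst sum.swap) (simp add: sum_distrib_left)

lemma bexp_cong: "(\<And>A. A \<subseteq> S \<Longrightarrow> f A = g A) \<Longrightarrow> bexp S p f = bexp S p g"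
  by (auto simp: bexp_def intro: sum.cong)

lemma bexp_const: "finite S \<Longrightarrow> bexp S p (\<lambda>_. c) = c"
  by (induction S rule: finite_induct) (simp_all add: bexp_insert algebra_simps)

lemma bexp_mono:
  assumes "0 \<le> p" "p \<le> 1" "\<And>A. A \<subseteq> S \<Longrightarrow> f A \<le> g A"
  shows "bexp S p f \<le> bexp S p g"
  unfolding bexp_def using assms by (intro sum_mono mult_left_mono) auto

lemma bexp_nonneg:
  assumes "0 \<le> p" "p \<le> 1" "\<And>A. A \<subseteq> S \<Longrightarrow> 0 \<le> f A"
  shows "0 \<le> bexp S p f"
  unfolding bexp_def using assms by (intro sum_nonneg) auto

text \<open>Fubini: the traces of the random set on disjoint sets are independent.\<close>

lemma bexp_Un_disjoint:
  assumes "finite S" "finite T" "S \<inter> T = {}"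
  shows "bexp (S \<union> T) p f = bexp S p (\<lambda>A. bexp T p (\<lambda>B. f (A \<union> B)))"
  using assms
proof (induction S arbitrary: f rule: finite_induct)
  case (insert x S)
  then have "bexp (insert x S \<union> T) p f = p * bexp (S \<union> T) p (\<lambda>A. f (insert x A)) + (1 - p) * bexp (S \<union> T) p f"
    by (simp add: bexp_insert)
  also have "\<dots> = bexp (insert x S) p (\<lambda>A. bexp T p (\<lambda>B. f (A \<union> B)))"
    using insert by (simp add: bexp_insert)
  finally show ?case .
qed simp

lemma bexp_all: "finite F \<Longrightarrow> bexp F p (\<lambda>A. of_bool (F \<subseteq> A)) = p ^ card F"
proof (induction F rule: finite_induct)
  case (insert x F)
  have 1: "bexp F p (\<lambda>A. of_bool (insert x F \<subseteq> insert x A)) = bexp F p (\<lambda>A. of_bool (F \<subseteq> A))"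
    using insert by (intro bexp_cong) auto
  have 2: "bexp F p (\<lambda>A. of_bool (insert x F \<subseteq> A)) = bexp F p (\<lambda>A. 0)"
    using insert by (intro bexp_cong) auto
  show ?case using insert 1 2 by (simp add: bexp_insert bexp_const)
qed simp

text \<open>The condition on \<open>g\<close> says that it ignores the points of F, so the two
  factors depend on disjoint sets of coordinates.\<close>

lemma bexp_superset_indep:
  assumes "finite S" "F \<subseteq> S" and g: "\<And>A. g A = g (A - F)"
  shows "bexp S p (\<lambda>A. of_bool (F \<subseteq> A) * g A) = p ^ card F * bexp S p g"
proof -
  have fin: "finite (S - F)" "finite F" "(S - F) \<inter> F = {}" and S: "S = (S - F) \<union> F"
    using assms finite_subset by auto
  have gU: "g (A \<union> B) = g A" if "A \<subseteq> S - F" "B \<subseteq> F" for A B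
  proof -
    have "(A \<union> B) - F = A - F" using that by auto
    then show ?thesis using g[of A] g[of "A \<union> B"] by simp
  qed
  have "bexp S p (\<lambda>A. of_bool (F \<subseteq> A) * g A)
      = bexp (S - F) p (\<lambda>A. bexp F p (\<lambda>B. of_bool (F \<subseteq> A \<union> B) * g (A \<union> B)))"
    by (subst S, subst bexp_Un_disjoint[OF fin]) simp
  also have "\<dots> = bexp (S - F) p (\<lambda>A. bexp F p (\<lambda>B. g A * of_bool (F \<subseteq> B)))"
    by (intro bexp_cong) (auto simp: gU of_bool_def)
  also have "\<dots> = p ^ card F * bexp (S - F) p g"
    using bexp_cmult[of "S - F" p "p ^ card F" g] by (simp add: bexp_cmult bexp_all fin mult.commute)
  also have "bexp (S - F) p g = bexp (S - F) p (\<lambda>A. bexp F p (\<lambda>B. g (A \<union> B)))"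
    by (intro bexp_cong) (simp add: gU bexp_const fin cong: bexp_cong)
  also have "\<dots> = bexp S p g"
    using S bexp_Un_disjoint[OF fin, of p g] by simp
  finally show ?thesis .
qed

lemma bexp_superset:
  assumes "finite S" "F \<subseteq> S"
  shows "bexp S p (\<lambda>A. of_bool (F \<subseteq> A)) = p ^ card F"
  using bexp_superset_indep[of S F "\<lambda>_. 1" p] assms by (simp add: bexp_const)

section \<open>Correlation inequalities of Harris and Janson\<close>

text \<open>Conditioned on a point x, the inequality holds by induction. Averaging over x can only
  help, since the conditional expectation of \<open>f\<close> rises and that of \<open>g\<close>
  falls when x is chosen.\<close>

lemma Harris_mono_antimono:
  assumes "finite S" "0 \<le> p" "p \<le> 1" "mono f" "antimono g"
  shows "bexp S p (\<lambda>A. f A * g A) \<le> bexp S p f * bexp S p g"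
  using assms(1,4,5)
proof (induction S arbitrary: f g rule: finite_induct)
  case (insert x S)
  let ?f = "\<lambda>A. f (insert x A)" and ?g = "\<lambda>A. g (insert x A)"
  have m: "mono ?f" "antimono ?g"
    using insert.prems unfolding mono_def antimono_def by (meson insert_mono)+
  have 1: "bexp S p (\<lambda>A. ?f A * ?g A) \<le> bexp S p ?f * bexp S p ?g"
    by (rule insert.IH[OF m])
  have 2: "bexp S p (\<lambda>A. f A * g A) \<le> bexp S p f * bexp S p g"
    by (rule insert.IH[OF insert.prems])
  have 3: "bexp S p f \<le> bexp S p ?f" "bexp S p ?g \<le> bexp S p g"
    using insert.prems assms by (auto intro!: bexp_mono simp: mono_def antimono_def subset_insertI)
  define a b u v where "a = bexp S p ?f" "b = bexp S p f" "u = bexp S p ?g" "v = bexp S p g"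
  \<comment> \<open>Up to sign this is the covariance of two functions on a two-point space, taking
    the values a, b and u, v.\<close>
  have "0 \<le> p * (1 - p) * ((a - b) * (v - u))"
    using 3 assms by (intro mult_nonneg_nonneg) (auto simp: a_b_u_v_def)
  moreover have "p * (a * u) + (1 - p) * (b * v) + p * (1 - p) * ((a - b) * (v - u))
      = (p * a + (1 - p) * b) * (p * u + (1 - p) * v)"
    by (simp add: algebra_simps)
  ultimately have "p * (a * u) + (1 - p) * (b * v) \<le> (p * a + (1 - p) * b) * (p * u + (1 - p) * v)"
    by linarith
  moreover have "p * bexp S p (\<lambda>A. ?f A * ?g A) + (1 - p) * bexp S p (\<lambda>A. f A * g A) \<le> p * (a * u) + (1 - p) * (b * v)"
    using 1 2 assms unfolding a_b_u_v_def by (intro add_mono mult_left_mono) auto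
  ultimately show ?case
    using insert by (simp add: bexp_insert a_b_u_v_def)
qed simp

lemma Harris_antimono:
  assumes "finite S" "0 \<le> p" "p \<le> 1" "antimono f" "antimono g"
  shows "bexp S p f * bexp S p g \<le> bexp S p (\<lambda>A. f A * g A)"
proof -
  have "mono (\<lambda>A. - f A)" using assms(4) by (auto simp: mono_def antimono_def)
  from Harris_mono_antimono[OF assms(1-3) this assms(5)] show ?thesis
    by (simp add: bexp_uminus)
qed

definition avoids :: "'a set set \<Rightarrow> 'a set \<Rightarrow> bool" where
  "avoids J A \<longleftrightarrow> (\<forall>F\<in>J. \<not> F \<subseteq> A)"

lemma antimono_avoids: "antimono (\<lambda>A. of_bool (avoids J A) :: real)"
  by (auto simp: antimono_def avoids_def of_bool_def)

lemma avoids_insert: "avoids (insert F J) A \<longleftrightarrow> \<not> F \<subseteq> A \<and> avoids J A"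
  by (auto simp: avoids_def)

text \<open>Each event "F is not contained in A" is decreasing, so Harris' inequality makes their
  conjunction at least as likely as under independence.\<close>

lemma avoids_ge_prod:
  assumes "finite S" "0 \<le> p" "p \<le> 1" "finite J" "\<And>F. F \<in> J \<Longrightarrow> F \<subseteq> S"
  shows "(\<Prod>F\<in>J. 1 - p ^ card F) \<le> bexp S p (\<lambda>A. of_bool (avoids J A))"
  using assms(4,5)
proof (induction J rule: finite_induct)
  case empty
  then show ?case by (simp add: avoids_def bexp_const assms)
next
  case (insert F J)
  have F: "bexp S p (\<lambda>A. of_bool (\<not> F \<subseteq> A)) = 1 - p ^ card F"
  proof -
    have "bexp S p (\<lambda>A. of_bool (\<not> F \<subseteq> A)) = bexp S p (\<lambda>A. 1 - of_bool (F \<subseteq> A))"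
      by (intro bexp_cong) auto
    then show ?thesis using insert.prems assms by (simp add: bexp_diff bexp_const bexp_superset)
  qed
  have "(\<Prod>F\<in>insert F J. 1 - p ^ card F) \<le> (1 - p ^ card F) * bexp S p (\<lambda>A. of_bool (avoids J A))"
    using insert assms by (auto intro!: mult_left_mono simp: power_le_one)
  also have "\<dots> \<le> bexp S p (\<lambda>A. of_bool (\<not> F \<subseteq> A) * of_bool (avoids J A))"
    unfolding F[symmetric]
    by (rule Harris_antimono[OF assms(1-3) _ antimono_avoids]) (auto simp: antimono_def)
  also have "\<dots> = bexp S p (\<lambda>A. of_bool (avoids (insert F J) A))"
    by (intro bexp_cong) (auto simp: avoids_insert)
  finally show ?case .
qed

text \<open>The core of Janson's inequality: a lower bound for the probability that F appears, given
  that J is avoided. Members of J disjoint from F are independent of the appearance of F. Each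
  member G meeting F is subtracted by a union bound, and Harris' inequality compares the increasing
  event that F and G appear with the decreasing one that the disjoint members are avoided.\<close>

lemma bexp_superset_avoids_ge:
  assumes "finite S" "0 \<le> p" "p \<le> 1" "finite J" "\<And>G. G \<in> J \<Longrightarrow> G \<subseteq> S" "F \<subseteq> S"
  shows "(p ^ card F - (\<Sum>G\<in>{G\<in>J. G \<inter> F \<noteq> {}}. p ^ card (F \<union> G))) * bexp S p (\<lambda>A. of_bool (avoids J A))
     \<le> bexp S p (\<lambda>A. of_bool (F \<subseteq> A) * of_bool (avoids J A))"
proof -
  let ?N = "{G\<in>J. G \<inter> F \<noteq> {}}" and ?D = "{G\<in>J. G \<inter> F = {}}"
  let ?d = "\<lambda>A. of_bool (avoids ?D A) :: real" and ?a = "\<lambda>A. of_bool (avoids J A) :: real"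
  define \<delta> where "\<delta> = p ^ card F - (\<Sum>G\<in>?N. p ^ card (F \<union> G))"
  have fin: "finite F" "finite ?N"
    using assms finite_subset by auto
  have ind: "bexp S p (\<lambda>A. of_bool (F \<subseteq> A) * ?d A) = p ^ card F * bexp S p ?d"
    by (rule bexp_superset_indep[OF assms(1,6)]) (auto simp: avoids_def of_bool_def)
  have har: "bexp S p (\<lambda>A. of_bool (F \<union> G \<subseteq> A) * ?d A) \<le> p ^ card (F \<union> G) * bexp S p ?d" if "G \<in> ?N" for G
  proof -
    have "bexp S p (\<lambda>A. of_bool (F \<union> G \<subseteq> A) * ?d A) \<le> bexp S p (\<lambda>A. of_bool (F \<union> G \<subseteq> A)) * bexp S p ?d"
      by (rule Harris_mono_antimono[OF assms(1-3) _ antimono_avoids]) (auto simp: mono_def of_bool_def)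
    moreover have "bexp S p (\<lambda>A. of_bool (F \<union> G \<subseteq> A)) = p ^ card (F \<union> G)"
      using that assms by (intro bexp_superset) auto
    ultimately show ?thesis by simp
  qed
  have "\<delta> * bexp S p ?d \<le> bexp S p (\<lambda>A. of_bool (F \<subseteq> A) * ?d A) - (\<Sum>G\<in>?N. bexp S p (\<lambda>A. of_bool (F \<union> G \<subseteq> A) * ?d A))"
    using sum_mono[of ?N, OF har] by (simp add: ind \<delta>_def left_diff_distrib sum_distrib_right)
  also have "\<dots> = bexp S p (\<lambda>A. of_bool (F \<subseteq> A) * ?d A - (\<Sum>G\<in>?N. of_bool (F \<union> G \<subseteq> A) * ?d A))"
    by (simp only: bexp_diff bexp_sum)
  also have "\<dots> \<le> bexp S p (\<lambda>A. of_bool (F \<subseteq> A) * ?a A)"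
  proof (rule bexp_mono[OF assms(2,3)])
    fix A
    have nn: "0 \<le> (\<Sum>G\<in>?N. of_bool (F \<union> G \<subseteq> A) * ?d A)"
      by (intro sum_nonneg) auto
    \<comment> \<open>The left side could exceed the right one only when F appears and some member
      of J appears but none disjoint from F; then a member meeting F contributes 1 to the subtracted
      sum.\<close>
    show "of_bool (F \<subseteq> A) * ?d A - (\<Sum>G\<in>?N. of_bool (F \<union> G \<subseteq> A) * ?d A) \<le> of_bool (F \<subseteq> A) * ?a A"
    proof (cases "F \<subseteq> A \<and> avoids ?D A \<and> \<not> avoids J A")
      case True
      then obtain G where "G \<in> J" "G \<subseteq> A" "\<not> G \<inter> F = {}"
        unfolding avoids_def by blast
      then have G: "G \<in> ?N" "G \<subseteq> A" by auto
      have "of_bool (F \<union> G \<subseteq> A) * ?d A \<le> (\<Sum>G\<in>?N. of_bool (F \<union> G \<subseteq> A) * ?d A)"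
        by (rule member_le_sum) (use G fin in auto)
      then show ?thesis using True G by simp
    next
      case False
      then have "of_bool (F \<subseteq> A) * ?d A \<le> of_bool (F \<subseteq> A) * ?a A" by (auto simp: of_bool_def)
      then show ?thesis using nn by linarith
    qed
  qed
  finally have main: "\<delta> * bexp S p ?d \<le> bexp S p (\<lambda>A. of_bool (F \<subseteq> A) * ?a A)" .
  have nn: "0 \<le> bexp S p ?a" "0 \<le> bexp S p (\<lambda>A. of_bool (F \<subseteq> A) * ?a A)"
    using assms by (auto intro!: bexp_nonneg)
  have le: "bexp S p ?a \<le> bexp S p ?d"
    using assms by (intro bexp_mono) (auto simp: avoids_def of_bool_def)
  \<comment> \<open>Passing from \<open>?d\<close> to the smaller \<open>?a\<close> preserves the
    bound if \<delta> is nonnegative; otherwise the left side is not positive anyway.\<close>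
  have "\<delta> * bexp S p ?a \<le> bexp S p (\<lambda>A. of_bool (F \<subseteq> A) * ?a A)"
  proof (cases "0 \<le> \<delta>")
    case True
    then show ?thesis using main mult_left_mono[OF le] by fastforce
  next
    case False
    then have "\<delta> * bexp S p ?a \<le> 0" using nn by (simp add: mult_nonpos_nonneg)
    then show ?thesis using nn by linarith
  qed
  then show ?thesis by (simp add: \<delta>_def)
qed

text \<open>Janson's inequality, up to the factor one half that usually stands before the sum over ordered pairs.\<close>

lemma Janson:
  assumes "finite S" "0 \<le> p" "p \<le> 1" "finite J" "\<And>F. F \<in> J \<Longrightarrow> F \<subseteq> S"
  shows "bexp S p (\<lambda>A. of_bool (avoids J A)) \<le>
    exp (- (\<Sum>F\<in>J. p ^ card F) + (\<Sum>(F,G)\<in>{(F,G)\<in>J \<times> J. F \<noteq> G \<and> F \<inter> G \<noteq> {}}. p ^ card (F \<union> G)))"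
  using assms(4,5)
proof (induction J rule: finite_induct)
  case empty
  then show ?case by (simp add: avoids_def bexp_const assms)
next
  case (insert F J)
  define P where "P J = {(F,G)\<in>J \<times> J. F \<noteq> G \<and> F \<inter> G \<noteq> {}}" for J :: "'a set set"
  let ?w = "\<lambda>(F,G). p ^ card (F \<union> G)" and ?N = "{G\<in>J. G \<inter> F \<noteq> {}}"
  define \<delta> where "\<delta> = p ^ card F - (\<Sum>G\<in>?N. p ^ card (F \<union> G))"
  define B where "B = bexp S p (\<lambda>A. of_bool (avoids J A))"
  have "bexp S p (\<lambda>A. of_bool (avoids (insert F J) A)) = bexp S p (\<lambda>A. of_bool (avoids J A) - of_bool (F \<subseteq> A) * of_bool (avoids J A))"
    by (intro bexp_cong) (auto simp: avoids_insert)
  also have "\<dots> \<le> B - \<delta> * B"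
    using bexp_superset_avoids_ge[OF assms(1-3) insert(1), of F] insert.prems
    by (simp add: bexp_diff B_def \<delta>_def)
  also have "\<dots> = B * (1 - \<delta>)" by (simp add: algebra_simps)
  \<comment> \<open>This turns the product of conditional probabilities into the exponential of a
    sum.\<close>
  also have "\<dots> \<le> B * exp (- \<delta>)"
    unfolding B_def using exp_ge_add_one_self[of "-\<delta>"] assms
    by (intro mult_left_mono bexp_nonneg) auto
  also have "\<dots> \<le> exp (- (\<Sum>F\<in>J. p ^ card F) + sum ?w (P J)) * exp (- \<delta>)"
    unfolding B_def P_def using insert by (intro mult_right_mono) auto
  also have "\<dots> = exp (- (\<Sum>F\<in>insert F J. p ^ card F) + (sum ?w (P J) + (\<Sum>G\<in>?N. p ^ card (F \<union> G))))"
    using insert by (simp add: \<delta>_def exp_add[symmetric] algebra_simps)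
  also have "\<dots> \<le> exp (- (\<Sum>F\<in>insert F J. p ^ card F) + sum ?w (P (insert F J)))"
  proof -
    have finP: "finite (P J')" if "finite J'" for J'
      using that by (intro finite_subset[of "P J'" "J' \<times> J'"]) (auto simp: P_def)
    have fin: "finite (P J)" "finite ?N" "finite (P (insert F J))"
      using insert(1) by (auto intro!: finP)
    \<comment> \<open>The new member F creates the ordered pairs (F, G) and (G, F) for each G in
      \<open>?N\<close>. Only the first kind is used, which is where the factor one half is given
      away.\<close>
    have "sum ?w (P J) + (\<Sum>G\<in>?N. p ^ card (F \<union> G)) = sum ?w (P J) + sum ?w (Pair F ` ?N)"
      by (simp add: sum.reindex inj_on_def)
    also have "\<dots> = sum ?w (P J \<union> Pair F ` ?N)"
      using insert fin by (subst sum.union_disjoint) (auto simp: P_def)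
    also have "\<dots> \<le> sum ?w (P (insert F J))"
      using insert(2) fin assms(2) by (intro sum_mono2) (auto simp: P_def)
    finally show ?thesis by simp
  qed
  finally show ?case unfolding P_def .
qed

section \<open>Counting cycles\<close>

text \<open>For lists of length 1 and 2 this degenerates to a singleton and to a single edge, whence
  the recurring condition \<open>2 < length xs\<close>.\<close>

definition cyc_edges :: "'a list \<Rightarrow> 'a set set" where
  "cyc_edges xs = (\<lambda>t. {xs ! t, xs ! (Suc t mod length xs)}) ` {..<length xs}"

lemma Suc_mod_eq: "t < k \<Longrightarrow> Suc t mod k = (if Suc t = k then 0 else Suc t)"
  by auto

lemma cyc_edges_nbr:
  assumes "distinct xs" "2 < length xs" "t < length xs"
  shows "{xs ! t, b} \<in> cyc_edges xs \<longleftrightarrow>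
    b = xs ! (Suc t mod length xs) \<or> b = xs ! (if t = 0 then length xs - 1 else t - 1)"
  (is "_ \<longleftrightarrow> ?R")
proof
  let ?k = "length xs"
  assume "{xs ! t, b} \<in> cyc_edges xs"
  then obtain s where s: "s < ?k" "{xs ! t, b} = {xs ! s, xs ! (Suc s mod ?k)}"
    by (auto simp: cyc_edges_def)
  then consider "xs ! t = xs ! s" "b = xs ! (Suc s mod ?k)" | "xs ! t = xs ! (Suc s mod ?k)" "b = xs ! s"
    by (auto simp: doubleton_eq_iff)
  then show ?R
  proof cases
    case 1
    then show ?thesis using assms s by (simp add: nth_eq_iff_index_eq)
  next
    case 2
    have "Suc s mod ?k < ?k" using s by (intro mod_less_divisor) linarith
    then have "t = Suc s mod ?k" using assms 2 nth_eq_iff_index_eq by blast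
    then have "s = (if t = 0 then ?k - 1 else t - 1)"
      using s by (auto simp: Suc_mod_eq split: if_splits)
    then show ?thesis using 2 by simp
  qed
next
  let ?k = "length xs"
  define s where "s = (if t = 0 then ?k - 1 else t - 1)"
  have s: "s < ?k" "Suc s mod ?k = t" using assms by (auto simp: s_def)
  assume ?R
  then consider "b = xs ! (Suc t mod ?k)" | "b = xs ! s" by (auto simp: s_def)
  then show "{xs ! t, b} \<in> cyc_edges xs"
  proof cases
    case 1 then show ?thesis using assms by (auto simp: cyc_edges_def)
  next
    case 2
    then have "{xs ! t, b} = {xs ! s, xs ! (Suc s mod ?k)}" using s by auto
    then show ?thesis using s by (auto simp: cyc_edges_def)
  qed
qed

text \<open>Equal edges at different positions would make each position the cyclic successor of the
  other, which is impossible beyond length 2.\<close>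

lemma inj_on_cyc_edges:
  assumes "distinct xs" "2 < length xs"
  shows "inj_on (\<lambda>t. {xs ! t, xs ! (Suc t mod length xs)}) {..<length xs}"
proof (rule inj_onI)
  let ?k = "length xs"
  fix s t assume st: "s \<in> {..<?k}" "t \<in> {..<?k}"
    and eq: "{xs ! s, xs ! (Suc s mod ?k)} = {xs ! t, xs ! (Suc t mod ?k)}"
  have "0 < ?k" using assms by linarith
  then have lt: "Suc s mod ?k < ?k" "Suc t mod ?k < ?k" by simp_all
  from eq have "s = t \<or> s = Suc t mod ?k \<and> t = Suc s mod ?k"
    using assms st lt by (auto simp add: doubleton_eq_iff nth_eq_iff_index_eq)
  then show "s = t" using assms st by (auto simp: Suc_mod_eq split: if_splits)
qed

lemma card_cyc_edges: "distinct xs \<Longrightarrow> 2 < length xs \<Longrightarrow> card (cyc_edges xs) = length xs"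
  by (simp add: cyc_edges_def card_image[OF inj_on_cyc_edges])

lemma finite_cyc_edges [simp]: "finite (cyc_edges xs)"
  by (simp add: cyc_edges_def)

lemma Union_cyc_edges: "\<Union> (cyc_edges xs) = set xs"
proof
  show "\<Union> (cyc_edges xs) \<subseteq> set xs"
    by (auto simp: cyc_edges_def intro!: nth_mem)
      (metis gr_implies_not0 length_greater_0_conv list.size(3) mod_less_divisor nth_mem)
  show "set xs \<subseteq> \<Union> (cyc_edges xs)"
    by (auto simp: cyc_edges_def in_set_conv_nth)
qed

lemma cyc_edges_rotate1: "cyc_edges (rotate1 xs) = cyc_edges xs"
proof (cases xs)
  case (Cons a as)
  let ?k = "length xs"
  have k: "0 < ?k" using Cons by simp
  have r: "rotate1 xs ! t = xs ! (Suc t mod ?k)" if "t < ?k" for t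
    using that by (simp add: nth_rotate1)
  have 1: "{rotate1 xs ! t, rotate1 xs ! (Suc t mod ?k)} = {xs ! (Suc t mod ?k), xs ! (Suc (Suc t mod ?k) mod ?k)}"
    if "t < ?k" for t
    using that k by (simp add: r)
  have "(\<lambda>t. Suc t mod ?k) ` {..<?k} = {..<?k}"
  proof
    show "{..<?k} \<subseteq> (\<lambda>t. Suc t mod ?k) ` {..<?k}"
    proof
      fix t assume "t \<in> {..<?k}"
      then have "t = Suc (if t = 0 then ?k - 1 else t - 1) mod ?k" "(if t = 0 then ?k - 1 else t - 1) \<in> {..<?k}"
        using k by auto
      then show "t \<in> (\<lambda>t. Suc t mod ?k) ` {..<?k}" by (rule image_eqI)
    qed
  qed (use k in auto)
  then have "cyc_edges xs = (\<lambda>t. {xs ! t, xs ! (Suc t mod ?k)}) ` ((\<lambda>t. Suc t mod ?k) ` {..<?k})"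
    by (simp add: cyc_edges_def)
  also have "\<dots> = cyc_edges (rotate1 xs)"
    unfolding cyc_edges_def image_image using 1 by (intro image_cong) auto
  finally show ?thesis by simp
qed simp

lemma cyc_edges_rotate: "cyc_edges (rotate r xs) = cyc_edges xs"
  by (induction r) (simp_all add: cyc_edges_rotate1)

lemma cyc_edges_rev: "cyc_edges (rev xs) = cyc_edges xs"
proof -
  have sub: "cyc_edges (rev xs) \<subseteq> cyc_edges xs" for xs :: "'a list"
  proof
    let ?k = "length xs"
    fix e assume "e \<in> cyc_edges (rev xs)"
    then obtain t where t: "t < ?k" "e = {rev xs ! t, rev xs ! (Suc t mod ?k)}"
      by (auto simp: cyc_edges_def)
    define s where "s = (if Suc t = ?k then ?k - 1 else ?k - 1 - Suc t)"
    have m: "Suc t mod ?k < ?k" using t by (intro mod_less_divisor) linarith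
    have s: "s < ?k" "?k - Suc (Suc t mod ?k) = s" "Suc s mod ?k = ?k - Suc t"
      using t by (auto simp: s_def Suc_mod_eq)
    have "e = {xs ! (?k - Suc t), xs ! s}"
      using t m s by (simp add: rev_nth)
    then have "e = {xs ! s, xs ! (Suc s mod ?k)}" using s by auto
    then show "e \<in> cyc_edges xs" using s by (auto simp: cyc_edges_def)
  qed
  from sub[of xs] sub[of "rev xs"] show ?thesis by simp
qed

text \<open>Each vertex has exactly two neighbours on the cycle, so after two consecutive entries
  the next one is forced: it is the neighbour from which the walk did not just come.\<close>

lemma cyc_edges_determine:
  assumes "distinct xs" "distinct ys" "2 < length xs" "length ys = length xs"
    and "cyc_edges xs = cyc_edges ys" "xs ! 0 = ys ! 0" "xs ! 1 = ys ! 1"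
  shows "xs = ys"
proof -
  let ?k = "length xs"
  have "Suc t < ?k \<Longrightarrow> xs ! t = ys ! t \<and> xs ! Suc t = ys ! Suc t" for t
  proof (induction t)
    case 0 then show ?case using assms by simp
  next
    case (Suc t)
    then have IH: "xs ! t = ys ! t" "xs ! Suc t = ys ! Suc t" by auto
    have "{xs ! Suc t, xs ! Suc (Suc t)} \<in> cyc_edges xs"
      using cyc_edges_nbr[of xs "Suc t" "xs ! Suc (Suc t)"] assms Suc.prems by (simp add: Suc_mod_eq)
    then have "{ys ! Suc t, xs ! Suc (Suc t)} \<in> cyc_edges ys" using assms IH by simp
    then have "xs ! Suc (Suc t) = ys ! Suc (Suc t) \<or> xs ! Suc (Suc t) = ys ! t"
      using cyc_edges_nbr[of ys "Suc t" "xs ! Suc (Suc t)"] assms Suc.prems by (simp add: Suc_mod_eq)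
    moreover have "xs ! Suc (Suc t) \<noteq> xs ! t" using assms Suc.prems by (simp add: nth_eq_iff_index_eq)
    ultimately show ?case using IH by simp
  qed
  then have *: "xs ! t = ys ! t" if "Suc t < ?k" for t using that by blast
  have "xs ! t = ys ! t" if "t < ?k" for t
  proof (cases "Suc t = ?k")
    case True
    then obtain u where "t = Suc u" "Suc u < ?k" using assms by (cases t) auto
    then show ?thesis using \<open>\<And>t. Suc t < ?k \<Longrightarrow> xs ! t = ys ! t \<and> xs ! Suc t = ys ! Suc t\<close> by blast
  qed (use * that in auto)
  then show ?thesis using assms by (intro nth_equalityI) auto
qed

definition dlists :: "'a set \<Rightarrow> nat \<Rightarrow> 'a list set" where
  "dlists V k = {xs. length xs = k \<and> distinct xs \<and> set xs \<subseteq> V}"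

lemma finite_dlists: "finite V \<Longrightarrow> finite (dlists V k)"
  using finite_lists_length_eq[of V k] by (auto elim!: rev_finite_subset simp: dlists_def)

text \<open>The dihedral group of order 2k acts freely by rotation and reversal, and its orbits are
  the fibres: the first entry of a list fixes the rotation and the second one the direction.\<close>

lemma cyc_edges_fibre:
  assumes "xs \<in> dlists V k" "2 < k"
  shows "card {ys \<in> dlists V k. cyc_edges ys = cyc_edges xs} = 2 * k"
proof -
  have xs: "length xs = k" "distinct xs" "set xs \<subseteq> V" using assms by (auto simp: dlists_def)
  let ?h = "\<lambda>(t, b). rotate t (if b then xs else rev xs)"
  have h0: "rotate t xs ! 0 = xs ! t" "rotate t xs ! 1 = xs ! (Suc t mod k)" if "t < k" for t
    using that assms xs by (simp_all add: nth_rotate)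
  \<comment> \<open>Reversal sends position t to k - 1 - t, so this rotation of the reversed list
    starts at \<open>xs ! t\<close> and runs backwards.\<close>
  have h1: "rotate (k - 1 - t) (rev xs) ! 0 = xs ! t"
    "rotate (k - 1 - t) (rev xs) ! 1 = xs ! (if t = 0 then k - 1 else t - 1)" if "t < k" for t
  proof -
    define r where "r = k - 1 - t"
    have r: "r < k" "k - Suc r = t" using that by (auto simp: r_def)
    show "rotate (k - 1 - t) (rev xs) ! 0 = xs ! t"
      using r xs by (simp add: nth_rotate rev_nth flip: r_def)
    have "rotate (k - 1 - t) (rev xs) ! 1 = rev xs ! (Suc r mod k)"
      unfolding r_def[symmetric] using r(1) xs assms(2) by (simp add: nth_rotate)
    also have "Suc r mod k = (if t = 0 then 0 else Suc r)"
      using r that by (auto simp: r_def)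
    also have "rev xs ! (if t = 0 then 0 else Suc r) = xs ! (if t = 0 then k - 1 else t - 1)"
      using r that xs by (auto simp: r_def rev_nth intro!: arg_cong[of _ _ "\<lambda>i. xs ! i"])
    finally show "rotate (k - 1 - t) (rev xs) ! 1 = xs ! (if t = 0 then k - 1 else t - 1)" .
  qed
  have "inj_on ?h ({..<k} \<times> UNIV)"
  proof (rule inj_onI)
    fix x y assume x: "x \<in> {..<k} \<times> UNIV" "y \<in> {..<k} \<times> UNIV" and h: "?h x = ?h y"
    obtain s b t c where xy: "x = (s, b)" "y = (t, c)" by (cases x, cases y)
    have st: "s \<in> {..<k}" "t \<in> {..<k}"
      and eq: "rotate s (if b then xs else rev xs) = rotate t (if c then xs else rev xs)"
      using x h xy by simp_all
    have st': "k - 1 - s < k" "k - 1 - t < k" using st by auto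
    have h2: "rotate u (rev xs) ! 0 = xs ! (k - 1 - u)" if "u < k" for u
    proof -
      have "k - 1 - (k - 1 - u) = u" "k - 1 - u < k" using that by auto
      then show ?thesis using h1(1)[of "k - 1 - u"] by simp
    qed
    have first: "xs ! (if b then s else k - 1 - s) = xs ! (if c then t else k - 1 - t)"
      using arg_cong[OF eq, of "\<lambda>ys. ys ! 0"] h0(1)[of s] h0(1)[of t] h2[of s] h2[of t] st
      by (cases b; cases c) auto
    then have ix: "(if b then s else k - 1 - s) = (if c then t else k - 1 - t)"
      using st st' xs by (auto simp: nth_eq_iff_index_eq split: if_splits)
    \<comment> \<open>For k > 2 the successor and the predecessor of a position differ, so a
      rotation and a reflection with the same first entry differ in the second.\<close>
    have ne: "xs ! (Suc u mod k) \<noteq> xs ! (if u = 0 then k - 1 else u - 1)" if "u < k" for u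
      using that xs assms by (auto simp: nth_eq_iff_index_eq Suc_mod_eq)
    have no: False if "rotate u xs = rotate v (rev xs)" "u = k - 1 - v" "u < k" "v < k" for u v
    proof -
      have v: "v = k - 1 - u" using that by simp
      have "xs ! (Suc u mod k) = rotate v (rev xs) ! 1" using h0(2)[of u] that by simp
      also have "\<dots> = xs ! (if u = 0 then k - 1 else u - 1)" unfolding v by (rule h1(2)[OF that(3)])
      finally show False using ne[OF that(3)] by contradiction
    qed
    have "b = c"
    proof (rule ccontr)
      assume "b \<noteq> c"
      then consider "b" "\<not> c" | "\<not> b" "c" by blast
      then show False
      proof cases
        case 1
        show False by (rule no[of s t]) (use 1 eq ix st in simp_all)
      next
        case 2
        show False by (rule no[of t s]) (use 2 eq[symmetric] ix[symmetric] st in simp_all)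
      qed
    qed
    then show "x = y" using ix st xy by (cases b) auto
  qed
  then have card: "card (?h ` ({..<k} \<times> UNIV)) = 2 * k"
    by (simp add: card_image card_cartesian_product UNIV_bool)
  have "{ys \<in> dlists V k. cyc_edges ys = cyc_edges xs} = ?h ` ({..<k} \<times> UNIV)"
  proof
    show "?h ` ({..<k} \<times> UNIV) \<subseteq> {ys \<in> dlists V k. cyc_edges ys = cyc_edges xs}"
      using xs by (auto simp: dlists_def cyc_edges_rotate cyc_edges_rev split: if_splits)
    show "{ys \<in> dlists V k. cyc_edges ys = cyc_edges xs} \<subseteq> ?h ` ({..<k} \<times> UNIV)"
    proof clarify
      fix ys assume ys: "ys \<in> dlists V k" and e: "cyc_edges ys = cyc_edges xs"
      have ys': "length ys = k" "distinct ys" using ys by (auto simp: dlists_def)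
      have "set ys = set xs" using e Union_cyc_edges by metis
      then obtain t where t: "t < k" "ys ! 0 = xs ! t"
        using assms xs ys' by (metis in_set_conv_nth less_nat_zero_code nth_mem not_gr_zero)
      have "{ys ! 0, ys ! 1} \<in> cyc_edges ys"
        using ys' assms cyc_edges_nbr[of ys 0 "ys ! 1"] by simp
      then have "{xs ! t, ys ! 1} \<in> cyc_edges xs" using e t by simp
      then consider "ys ! 1 = xs ! (Suc t mod k)" | "ys ! 1 = xs ! (if t = 0 then k - 1 else t - 1)"
        using cyc_edges_nbr[of xs t "ys ! 1"] xs assms t by auto
      then show "ys \<in> ?h ` ({..<k} \<times> UNIV)"
      proof cases
        case 1
        have "ys = rotate t xs"
          by (rule cyc_edges_determine) (use 1 xs ys' assms t e h0[OF t(1)] in \<open>simp_all add: cyc_edges_rotate\<close>)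
        then show ?thesis using t by (intro image_eqI[of _ _ "(t, True)"]) auto
      next
        case 2
        have "ys = rotate (k - 1 - t) (rev xs)"
          by (rule cyc_edges_determine) (use 2 xs ys' assms t e h1[OF t(1)] in \<open>simp_all only: cyc_edges_rotate cyc_edges_rev length_rotate length_rev distinct_rotate distinct_rev\<close>)
        then show ?thesis using t by (intro image_eqI[of _ _ "(k - 1 - t, False)"]) auto
      qed
    qed
  qed
  with card show ?thesis by simp
qed

lemma card_cyc_sets:
  assumes "finite V" "2 < k"
  shows "2 * k * card (cyc_edges ` dlists V k) = card (dlists V k)"
proof -
  have "card (dlists V k) = (\<Sum>F\<in>cyc_edges ` dlists V k. card {ys \<in> dlists V k. cyc_edges ys = F})"
    using sum.image_gen[OF finite_dlists[OF assms(1), of k], of "\<lambda>_. 1::nat" cyc_edges] by simp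
  also have "\<dots> = (\<Sum>F\<in>cyc_edges ` dlists V k. 2 * k)"
    using assms by (intro sum.cong) (auto simp: cyc_edges_fibre)
  finally show ?thesis by (simp add: mult.commute)
qed

section \<open>Overlapping cycles and expected numbers of cycles\<close>

text \<open>Charge every new vertex of ys to the edge by which ys leaves it. These edges are new,
  and so is the edge by which ys first enters the new vertices from an old one; the shared edge
  guarantees that an old vertex exists. If there are no new vertices, there is still a new
  edge.\<close>

lemma card_cyc_edges_diff:
  assumes "distinct ys" "2 < length ys" "\<not> cyc_edges ys \<subseteq> cyc_edges xs" "cyc_edges xs \<inter> cyc_edges ys \<noteq> {}"
  shows "card (set ys - set xs) < card (cyc_edges ys - cyc_edges xs)"
proof (cases "set ys \<subseteq> set xs")
  case True
  then have "set ys - set xs = {}" by auto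
  moreover have "0 < card (cyc_edges ys - cyc_edges xs)" using assms by (auto simp: card_gt_0_iff)
  ultimately show ?thesis by (simp only: card.empty)
next
  case False
  let ?l = "length ys"
  define J where "J = {t. t < ?l \<and> ys ! t \<notin> set xs}"
  define e where "e t = {ys ! t, ys ! (Suc t mod ?l)}" for t
  have sub: "\<And>A. A \<in> cyc_edges xs \<Longrightarrow> A \<subseteq> set xs" using Union_cyc_edges[of xs] by blast
  obtain s where s: "s < ?l" "e s \<in> cyc_edges xs" using assms by (auto simp: cyc_edges_def e_def)
  then have sJ: "s \<notin> J" using sub[of "e s"] by (auto simp: J_def e_def)
  obtain y where "y \<in> set ys" "y \<notin> set xs" using False by auto
  then obtain j where j: "j \<in> J" unfolding J_def in_set_conv_nth[of y ys] by auto
  \<comment> \<open>Otherwise walking round the cycle from the old position s would never enter J,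
    although it reaches j.\<close>
  have "\<exists>t<?l. t \<notin> J \<and> Suc t mod ?l \<in> J"
  proof (rule ccontr)
    assume neg: "\<not> ?thesis"
    have "(s + m) mod ?l \<notin> J" for m
    proof (induction m)
      case (Suc m)
      have "(s + m) mod ?l < ?l" using assms(2) by (intro mod_less_divisor) linarith
      then have "Suc ((s + m) mod ?l) mod ?l \<notin> J" using neg Suc by blast
      then show ?case by (simp add: mod_Suc_eq)
    qed (use sJ s in auto)
    from this[of "j + ?l - s"] show False using j s by (auto simp: J_def)
  qed
  then obtain t where t: "t < ?l" "t \<notin> J" "Suc t mod ?l \<in> J" by blast
  have "e ` insert t J \<subseteq> cyc_edges ys - cyc_edges xs"
  proof -
    have "\<not> e u \<subseteq> set xs" if "u \<in> insert t J" for u using that t by (auto simp: e_def J_def)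
    moreover have "e u \<in> cyc_edges ys" if "u \<in> insert t J" for u
      using that t by (auto simp: e_def J_def cyc_edges_def)
    ultimately show ?thesis using sub by blast
  qed
  then have "card (e ` insert t J) \<le> card (cyc_edges ys - cyc_edges xs)"
    by (intro card_mono) auto
  moreover have "inj_on e (insert t J)"
    unfolding e_def by (rule inj_on_subset[OF inj_on_cyc_edges[OF assms(1,2)]]) (use t in \<open>auto simp: J_def\<close>)
  moreover have "finite J" by (auto simp: J_def)
  ultimately have "Suc (card J) \<le> card (cyc_edges ys - cyc_edges xs)"
    using t by (simp add: card_image)
  moreover have "set ys - set xs = (!) ys ` J" by (auto simp: J_def in_set_conv_nth)
  then have "card (set ys - set xs) \<le> card J" using \<open>finite J\<close> by (simp add: card_image_le)
  ultimately show ?thesis by simp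
qed

text \<open>The surplus edge yields an extra factor p against the number of ways to choose the
  vertices. Of two distinct edge sets one is not contained in the other, and the difference lemma is
  applied to that one.\<close>

lemma card_cyc_edges_Un:
  assumes "distinct xs" "2 < length xs" "distinct ys" "2 < length ys"
    and "cyc_edges xs \<noteq> cyc_edges ys" "cyc_edges xs \<inter> cyc_edges ys \<noteq> {}"
  shows "card (set xs \<union> set ys) < card (cyc_edges xs \<union> cyc_edges ys)"
proof -
  have gen: "card (set xs \<union> set ys) < card (cyc_edges xs \<union> cyc_edges ys)"
    if "distinct xs" "2 < length xs" "distinct ys" "2 < length ys"
      "\<not> cyc_edges ys \<subseteq> cyc_edges xs" "cyc_edges xs \<inter> cyc_edges ys \<noteq> {}" for xs ys :: "'a list"
  proof -
    have "card (set xs \<union> set ys) = card (set xs) + card (set ys - set xs)"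
      by (subst card_Un_disjoint[symmetric]) auto
    moreover have "card (cyc_edges xs \<union> cyc_edges ys) = card (cyc_edges xs) + card (cyc_edges ys - cyc_edges xs)"
      by (subst card_Un_disjoint[symmetric]) auto
    ultimately show ?thesis
      using card_cyc_edges_diff[of ys xs] that by (simp add: card_cyc_edges distinct_card)
  qed
  consider "\<not> cyc_edges ys \<subseteq> cyc_edges xs" | "\<not> cyc_edges xs \<subseteq> cyc_edges ys" using assms by auto
  then show ?thesis
  proof cases
    case 1 then show ?thesis using gen[of xs ys] assms by blast
  next
    case 2 then show ?thesis using gen[of ys xs] assms by (simp add: Un_commute Int_commute)
  qed
qed

text \<open>List entries are added one at a time: an entry either repeats a point already present,
  with few choices and no factor, or is new, with at most \<open>card V\<close> choices and a factor
  p. When p is c/n and V has n points, the base of the power does not grow with n.\<close>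

lemma sum_power_card_set_le:
  fixes p :: real
  assumes "finite V" "0 \<le> p" "finite A"
  shows "(\<Sum>xs\<in>{xs. set xs \<subseteq> V \<and> length xs = L}. p ^ card (A \<union> set xs))
    \<le> p ^ card A * (card A + L + card V * p) ^ L"
  using assms(3)
proof (induction L arbitrary: A)
  case 0
  have "{xs. set xs \<subseteq> V \<and> length xs = 0} = {[]}" by auto
  then show ?case by simp
next
  case (Suc L)
  define B where "B = card A + Suc L + card V * p"
  let ?L = "\<lambda>L. {xs. set xs \<subseteq> V \<and> length xs = L}"
  have eq: "?L (Suc L) = (\<lambda>(a, xs). a # xs) ` (V \<times> ?L L)"
    by (auto simp: length_Suc_conv image_iff)
  have "(\<Sum>xs\<in>?L (Suc L). p ^ card (A \<union> set xs)) = (\<Sum>a\<in>V. \<Sum>xs\<in>?L L. p ^ card (insert a A \<union> set xs))"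
    unfolding eq by (subst sum.reindex) (simp_all add: inj_on_def sum.cartesian_product case_prod_unfold)
  also have "\<dots> \<le> (\<Sum>a\<in>V. p ^ card (insert a A) * B ^ L)"
  proof (rule sum_mono)
    fix a
    have "(\<Sum>xs\<in>?L L. p ^ card (insert a A \<union> set xs)) \<le> p ^ card (insert a A) * (card (insert a A) + L + card V * p) ^ L"
      by (rule Suc.IH) (use Suc.prems in auto)
    also have "\<dots> \<le> p ^ card (insert a A) * B ^ L"
      using assms Suc.prems by (intro mult_left_mono power_mono) (auto simp: B_def card_insert_if)
    finally show "(\<Sum>xs\<in>?L L. p ^ card (insert a A \<union> set xs)) \<le> p ^ card (insert a A) * B ^ L" .
  qed
  also have "\<dots> = (\<Sum>a\<in>V. p ^ card (insert a A)) * B ^ L"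
    by (simp add: sum_distrib_right)
  also have "\<dots> \<le> (p ^ card A * B) * B ^ L"
  proof (rule mult_right_mono)
    have "(\<Sum>a\<in>V. p ^ card (insert a A)) \<le> (\<Sum>a\<in>V. p ^ card A * (of_bool (a \<in> A) + p))"
      using assms Suc.prems by (intro sum_mono) (auto simp: card_insert_if insert_absorb algebra_simps)
    also have "\<dots> = p ^ card A * (card (V \<inter> A) + card V * p)"
      using assms by (simp add: sum_distrib_left[symmetric] sum.distrib Int_def)
    also have "\<dots> \<le> p ^ card A * B"
      using assms Suc.prems card_mono[of A "V \<inter> A"] by (intro mult_left_mono) (auto simp: B_def)
    finally show "(\<Sum>a\<in>V. p ^ card (insert a A)) \<le> p ^ card A * B" .
    show "0 \<le> B ^ L" using assms by (simp add: B_def)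
  qed
  finally show ?case by (simp add: B_def mult.assoc)
qed

definition cyc_sets :: "'a set \<Rightarrow> nat set \<Rightarrow> 'a set set set" where
  "cyc_sets V I = (\<Union>k\<in>I. cyc_edges ` dlists V k)"

lemma finite_cyc_sets: "finite V \<Longrightarrow> finite I \<Longrightarrow> finite (cyc_sets V I)"
  by (simp add: cyc_sets_def finite_dlists)

text \<open>With \<open>g k = p ^ k\<close> this is the expected number of cycles with length in I;
  the divisor 2k is the size of a dihedral fibre.\<close>

lemma sum_cyc_sets:
  fixes g :: "nat \<Rightarrow> real"
  assumes "finite V" "finite I" "\<And>k. k \<in> I \<Longrightarrow> 2 < k"
  shows "(\<Sum>F\<in>cyc_sets V I. g (card F)) = (\<Sum>k\<in>I. real (card (dlists V k)) / (2 * k) * g k)"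
proof -
  have crd: "card F = k" if "F \<in> cyc_edges ` dlists V k" "k \<in> I" for F k
    using that assms(3)[of k] by (auto simp: dlists_def card_cyc_edges)
  have "(\<Sum>F\<in>cyc_sets V I. g (card F)) = (\<Sum>k\<in>I. \<Sum>F\<in>cyc_edges ` dlists V k. g (card F))"
    unfolding cyc_sets_def
  proof (rule sum.UNION_disjoint)
    show "\<forall>i\<in>I. \<forall>j\<in>I. i \<noteq> j \<longrightarrow> cyc_edges ` dlists V i \<inter> cyc_edges ` dlists V j = {}"
      using crd by (metis disjoint_iff)
  qed (use assms in \<open>auto simp: finite_dlists\<close>)
  also have "\<dots> = (\<Sum>k\<in>I. real (card (dlists V k)) / (2 * k) * g k)"
  proof (rule sum.cong[OF refl])
    fix k assume k: "k \<in> I"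
    have "(\<Sum>F\<in>cyc_edges ` dlists V k. g (card F)) = real (card (cyc_edges ` dlists V k)) * g k"
      using crd k by simp
    also have "real (card (cyc_edges ` dlists V k)) = real (card (dlists V k)) / (2 * k)"
      using card_cyc_sets[OF assms(1) assms(3)[OF k]] assms(3)[OF k] by (simp add: field_simps flip: of_nat_mult)
    finally show "(\<Sum>F\<in>cyc_edges ` dlists V k. g (card F)) = real (card (dlists V k)) / (2 * k) * g k" .
  qed
  finally show ?thesis .
qed

text \<open>The error term of Janson's inequality. The leading factor p comes from the surplus edge;
  what remains is a sum over two lists of length at most K, bounded one list at a time. In the base,
  2K accounts for the points already present and the length of the list, and the summand 1 ensures
  that powers increase with the exponent; \<open>Suc K\<close> counts the lengths.\<close>

lemma sum_cyc_sets_pairs_le: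
  fixes p :: real
  assumes "finite V" "0 \<le> p" "p \<le> 1" "I \<subseteq> {3..K}"
  shows "(\<Sum>(F,G)\<in>{(F,G)\<in>cyc_sets V I \<times> cyc_sets V I. F \<noteq> G \<and> F \<inter> G \<noteq> {}}. p ^ card (F \<union> G))
    \<le> p * (Suc K * (2 * K + 1 + card V * p) ^ K)\<^sup>2"
proof -
  let ?w = "\<lambda>(F, G). p ^ card (F \<union> G)" and ?L = "\<lambda>L. {xs. set xs \<subseteq> V \<and> length xs = L}"
  define D where "D = 2 * K + 1 + card V * p"
  have D: "1 \<le> D" using assms by (simp add: D_def)
  define C where "C = (\<Union>L\<in>{..K}. ?L L)"
  have finC: "finite C" using assms by (auto simp: C_def finite_lists_length_eq)
  have sumC: "(\<Sum>xs\<in>C. p ^ card (A \<union> set xs)) \<le> p ^ card A * (Suc K * D ^ K)" if A: "finite A" "card A \<le> K" for A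
  proof -
    have "(\<Sum>xs\<in>C. p ^ card (A \<union> set xs)) = (\<Sum>L\<le>K. \<Sum>xs\<in>?L L. p ^ card (A \<union> set xs))"
      unfolding C_def using assms by (intro sum.UNION_disjoint) (auto simp: finite_lists_length_eq)
    also have "\<dots> \<le> (\<Sum>L\<le>K. p ^ card A * D ^ K)"
    proof (rule sum_mono)
      fix L assume L: "L \<in> {..K}"
      have "(\<Sum>xs\<in>?L L. p ^ card (A \<union> set xs)) \<le> p ^ card A * (card A + L + card V * p) ^ L"
        by (rule sum_power_card_set_le) (use assms A in auto)
      also have "\<dots> \<le> p ^ card A * D ^ L"
        using assms A L by (intro mult_left_mono power_mono) (auto simp: D_def)
      also have "\<dots> \<le> p ^ card A * D ^ K"
        using assms D L by (intro mult_left_mono power_increasing) auto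
      finally show "(\<Sum>xs\<in>?L L. p ^ card (A \<union> set xs)) \<le> p ^ card A * D ^ K" .
    qed
    finally show ?thesis by (simp add: algebra_simps)
  qed
  define M where "M = {(xs, ys) \<in> C \<times> C. distinct xs \<and> distinct ys \<and> 2 < length xs \<and> 2 < length ys \<and>
    cyc_edges xs \<noteq> cyc_edges ys \<and> cyc_edges xs \<inter> cyc_edges ys \<noteq> {}}"
  have finM: "finite M" using finC by (auto simp: M_def intro: finite_subset[of _ "C \<times> C"])
  have "{(F,G)\<in>cyc_sets V I \<times> cyc_sets V I. F \<noteq> G \<and> F \<inter> G \<noteq> {}} \<subseteq> map_prod cyc_edges cyc_edges ` M"
  proof clarify
    fix F G assume FG: "F \<in> cyc_sets V I" "G \<in> cyc_sets V I" "F \<noteq> G" "F \<inter> G \<noteq> {}"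
    then obtain k l xs ys where "k \<in> I" "l \<in> I" "xs \<in> dlists V k" "ys \<in> dlists V l" "F = cyc_edges xs" "G = cyc_edges ys"
      by (auto simp: cyc_sets_def)
    moreover from this have "(xs, ys) \<in> M"
      using FG assms(4) by (fastforce simp: M_def C_def dlists_def)
    ultimately show "(F, G) \<in> map_prod cyc_edges cyc_edges ` M"
      by (intro image_eqI[of _ _ "(xs, ys)"]) auto
  qed
  then have "sum ?w {(F,G)\<in>cyc_sets V I \<times> cyc_sets V I. F \<noteq> G \<and> F \<inter> G \<noteq> {}} \<le> sum ?w (map_prod cyc_edges cyc_edges ` M)"
    using finM assms by (intro sum_mono2) auto
  also have "\<dots> \<le> sum (?w \<circ> map_prod cyc_edges cyc_edges) M"
    using finM assms by (intro sum_image_le) auto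
  also have "\<dots> \<le> (\<Sum>(xs, ys)\<in>M. p * p ^ card (set xs \<union> set ys))"
  proof (rule sum_mono, clarify)
    fix xs ys assume "(xs, ys) \<in> M"
    then have "Suc (card (set xs \<union> set ys)) \<le> card (cyc_edges xs \<union> cyc_edges ys)"
      using card_cyc_edges_Un[of xs ys] by (auto simp: M_def)
    then have "p ^ card (cyc_edges xs \<union> cyc_edges ys) \<le> p ^ Suc (card (set xs \<union> set ys))"
      using assms by (intro power_decreasing) auto
    then show "(?w \<circ> map_prod cyc_edges cyc_edges) (xs, ys) \<le> p * p ^ card (set xs \<union> set ys)" by simp
  qed
  also have "\<dots> \<le> (\<Sum>(xs, ys)\<in>C \<times> C. p * p ^ card (set xs \<union> set ys))"
    using finC assms by (intro sum_mono2) (auto simp: M_def)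
  also have "\<dots> = p * (\<Sum>xs\<in>C. \<Sum>ys\<in>C. p ^ card (set xs \<union> set ys))"
    by (simp add: sum.cartesian_product[symmetric] sum_distrib_left)
  also have "\<dots> \<le> p * (\<Sum>xs\<in>C. p ^ card (set xs) * (Suc K * D ^ K))"
    using assms by (intro mult_left_mono sum_mono sumC) (auto simp: C_def intro: order_trans[OF card_length])
  also have "\<dots> = p * ((\<Sum>xs\<in>C. p ^ card (set xs)) * (Suc K * D ^ K))"
    by (simp add: sum_distrib_right)
  also have "\<dots> \<le> p * ((Suc K * D ^ K) * (Suc K * D ^ K))"
    using assms D sumC[of "{}"] by (intro mult_left_mono mult_right_mono) auto
  finally show ?thesis by (simp add: D_def power2_eq_square add_ac)
qed

section \<open>Short cycles in the sparse random graph\<close>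

definition has_bad_cycle :: "'a set set \<Rightarrow> bool" where
  "has_bad_cycle E \<longleftrightarrow> (\<exists>xs. distinct xs \<and> 2 < length xs \<and> length xs \<noteq> 4 \<and> cyc_edges xs \<subseteq> E)"

lemma all_pairs_eq: "all_pairs n = {A. A \<subseteq> {..<n} \<and> card A = 2}"
  by (auto simp: all_pairs_def card_2_iff)

lemma card_all_pairs: "card (all_pairs n) = n choose 2"
  by (simp add: all_pairs_eq n_subsets)

lemma finite_all_pairs [simp]: "finite (all_pairs n)"
  by (simp add: all_pairs_eq)

lemma gnp_prob_eq_bexp: "gnp_prob n p P = bexp (all_pairs n) p (\<lambda>E. of_bool (P E))"
  unfolding gnp_prob_def bexp_def by (intro sum.cong) auto

lemma cyc_edges_subset_all_pairs:
  assumes "distinct xs" "2 < length xs" "set xs \<subseteq> {..<n}"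
  shows "cyc_edges xs \<subseteq> all_pairs n"
proof
  fix e assume "e \<in> cyc_edges xs"
  then obtain t where t: "t < length xs" "e = {xs ! t, xs ! (Suc t mod length xs)}"
    by (auto simp: cyc_edges_def)
  have m: "Suc t mod length xs < length xs" using assms(2) by (intro mod_less_divisor) linarith
  have "Suc t mod length xs \<noteq> t" using t assms by (auto simp: Suc_mod_eq)
  then have "xs ! t \<noteq> xs ! (Suc t mod length xs)"
    using assms t m by (simp add: nth_eq_iff_index_eq)
  moreover have "xs ! t \<in> {..<n}" "xs ! (Suc t mod length xs) \<in> {..<n}"
    using assms(3) t m nth_mem by blast+
  ultimately show "e \<in> all_pairs n" unfolding all_pairs_def t(2) by auto
qed

lemma cyc_sets_subset_all_pairs:
  assumes "F \<in> cyc_sets {..<n} I" "\<And>k. k \<in> I \<Longrightarrow> 2 < k"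
  shows "F \<subseteq> all_pairs n"
  using assms by (auto simp: cyc_sets_def dlists_def dest!: cyc_edges_subset_all_pairs)

text \<open>A cycle on n vertices has length at most n, so finitely many forbidden edge sets suffice
  and the correlation inequalities apply.\<close>

lemma has_bad_cycle_iff:
  assumes "E \<subseteq> all_pairs n"
  shows "has_bad_cycle E \<longleftrightarrow> \<not> avoids (cyc_sets {..<n} ({3..n} - {4})) E"
proof
  assume "has_bad_cycle E"
  then obtain xs where xs: "distinct xs" "2 < length xs" "length xs \<noteq> 4" "cyc_edges xs \<subseteq> E"
    by (auto simp: has_bad_cycle_def)
  have "set xs \<subseteq> {..<n}"
    using xs assms Union_cyc_edges[of xs] by (fastforce simp: all_pairs_eq)
  moreover from this have "length xs \<le> n"
    using xs(1) card_mono[of "{..<n}" "set xs"] by (simp add: distinct_card)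
  ultimately have "cyc_edges xs \<in> cyc_sets {..<n} ({3..n} - {4})"
    using xs by (auto simp: cyc_sets_def dlists_def)
  then show "\<not> avoids (cyc_sets {..<n} ({3..n} - {4})) E"
    using xs by (auto simp: avoids_def)
next
  assume "\<not> avoids (cyc_sets {..<n} ({3..n} - {4})) E"
  then show "has_bad_cycle E"
    by (auto simp: avoids_def cyc_sets_def dlists_def has_bad_cycle_def)
qed

lemma card_dlists: "k \<le> n \<Longrightarrow> card (dlists {..<n} k) = \<Prod>{n - k + 1..n}"
  unfolding dlists_def using card_lists_distinct_length_eq[of "{..<n}" k]
  by (simp add: conj_commute conj_left_commute)

lemma card_dlists_le: "card (dlists {..<n} k) \<le> n ^ k"
proof -
  have "card (dlists {..<n} k) \<le> card {xs. set xs \<subseteq> {..<n} \<and> length xs = k}"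
    by (rule card_mono) (auto simp: dlists_def finite_lists_length_eq)
  then show ?thesis by (simp add: card_lists_length_eq)
qed

lemma card_dlists_ge:
  assumes "k \<le> n" shows "(real n - real k) ^ k \<le> card (dlists {..<n} k)"
proof -
  have "(real n - real k) ^ k = (\<Prod>i\<in>{n - k + 1..n}. real n - real k)"
    using assms by simp
  also have "\<dots> \<le> (\<Prod>i\<in>{n - k + 1..n}. real i)"
    using assms by (intro prod_mono) (auto simp: of_nat_diff)
  finally show ?thesis using assms by (simp add: card_dlists)
qed

text \<open>The falling factorial lies between (n - k)^k and n^k, both asymptotic to n^k for fixed
  k.\<close>

lemma card_dlists_times_tendsto: "(\<lambda>n. card (dlists {..<n} k) * (c / real n) ^ k) \<longlonglongrightarrow> c ^ k"
proof -
  have "(\<lambda>n. card (dlists {..<n} k) / real n ^ k) \<longlonglongrightarrow> 1"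
  proof (rule tendsto_sandwich)
    have "(\<lambda>n. (1 - real k * (1 / real n)) ^ k) \<longlonglongrightarrow> (1 - real k * 0) ^ k"
      by (intro tendsto_intros lim_1_over_n)
    then show "(\<lambda>n. (1 - real k / real n) ^ k) \<longlonglongrightarrow> 1" by simp
    show "\<forall>\<^sub>F n in sequentially. (1 - real k / real n) ^ k \<le> card (dlists {..<n} k) / real n ^ k"
      using eventually_ge_at_top[of "Suc k"]
    proof eventually_elim
      case (elim n)
      have "(1 - real k / real n) ^ k = (real n - real k) ^ k / real n ^ k"
        using elim by (simp add: diff_divide_distrib flip: power_divide)
      also have "\<dots> \<le> card (dlists {..<n} k) / real n ^ k"
        using elim card_dlists_ge[of k n] by (intro divide_right_mono) auto
      finally show ?case .
    qed
    show "\<forall>\<^sub>F n in sequentially. card (dlists {..<n} k) / real n ^ k \<le> 1"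
      using eventually_ge_at_top[of 1]
    proof eventually_elim
      case (elim n)
      have "real (card (dlists {..<n} k)) \<le> real n ^ k"
        using card_dlists_le[of n k] by (simp flip: of_nat_power)
      then show ?case using elim by (simp add: divide_le_eq)
    qed
  qed simp
  then have "(\<lambda>n. (card (dlists {..<n} k) / real n ^ k) * c ^ k) \<longlonglongrightarrow> 1 * c ^ k"
    by (intro tendsto_intros)
  then show ?thesis by (simp add: power_divide)
qed

lemma bad_cycle_series:
  fixes c :: real
  assumes "0 < c" "c < 1"
  shows "(\<lambda>k. if k < 3 \<or> k = 4 then 0 else c ^ k / (2 * k)) sums - ((1/2) * ln (1 - c) + c/2 + c^2/4 + c^4/8)"
proof -
  have "(\<lambda>k. (-1/2) * (- ((- (- c)) ^ k) / of_nat k)) sums ((-1/2) * ln (1 + - c))"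
    using assms by (intro sums_mult ln_series') auto
  then have "(\<lambda>k. c ^ k / (2 * k)) sums - ((1/2) * ln (1 - c))"
    by (simp add: field_simps)
  \<comment> \<open>Index 0 may be listed among the removed ones: its term divides by zero and
    therefore has the value 0.\<close>
  moreover have "(\<lambda>k. if k \<in> {0,1,2,4::nat} then c ^ k / (2 * k) else 0) sums (\<Sum>k\<in>{0,1,2,4::nat}. c ^ k / (2 * k))"
    by (rule sums_If_finite_set) simp
  ultimately have "(\<lambda>k. c ^ k / (2 * k) - (if k \<in> {0,1,2,4::nat} then c ^ k / (2 * k) else 0)) sums
      (- ((1/2) * ln (1 - c)) - (\<Sum>k\<in>{0,1,2,4::nat}. c ^ k / (2 * k)))"
    by (rule sums_diff)
  moreover have "(\<lambda>k. c ^ k / (2 * k) - (if k \<in> {0,1,2,4::nat} then c ^ k / (2 * k) else 0)) =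
      (\<lambda>k. if k < 3 \<or> k = 4 then 0 else c ^ k / (2 * k))"
    by (rule ext) (auto simp: less_Suc_eq numeral_3_eq_3)
  moreover have "- ((1/2) * ln (1 - c)) - (\<Sum>k\<in>{0,1,2,4::nat}. c ^ k / (2 * k)) =
      - ((1/2) * ln (1 - c) + c/2 + c^2/4 + c^4/8)"
    by simp
  ultimately show ?thesis by (simp only:)
qed

text \<open>A converse of \<open>1 - x \<le> exp (- x)\<close> at the price of the factor 1/(1 - p),
  obtained from 1/(1 - x) = 1 + x/(1 - x).\<close>

lemma one_minus_ge_exp:
  fixes x :: real
  assumes "0 \<le> x" "x \<le> p" "p < 1"
  shows "exp (- (x / (1 - p))) \<le> 1 - x"
proof -
  have "x / (1 - x) \<le> x / (1 - p)" using assms by (intro divide_left_mono mult_pos_pos) auto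
  moreover have "inverse (1 - x) = 1 + x / (1 - x)" using assms by (simp add: field_simps)
  ultimately have "inverse (1 - x) \<le> 1 + x / (1 - p)" by linarith
  also have "\<dots> \<le> exp (x / (1 - p))" by (rule exp_ge_add_one_self)
  finally have "inverse (1 - x) \<le> exp (x / (1 - p))" .
  then have "inverse (exp (x / (1 - p))) \<le> inverse (inverse (1 - x))"
    using assms by (intro le_imp_inverse_le) auto
  then show ?thesis by (simp add: exp_minus)
qed

lemma gnp_prob_no_bad_cycle_tendsto:
  fixes c :: real
  assumes c: "0 < c" "c < 1"
  defines "c' \<equiv> (1/2) * ln (1 - c) + c/2 + c^2/4 + c^4/8"
  shows "(\<lambda>n. gnp_prob n (c / real n) (\<lambda>E. \<not> has_bad_cycle E)) \<longlonglongrightarrow> exp c'"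
proof -
  define a where "a k = (if k < 3 \<or> k = 4 then 0 else c ^ k / (2 * k))" for k :: nat
  have a_nn: "0 \<le> a k" for k using c by (simp add: a_def)
  have a_sums: "a sums (- c')" unfolding a_def c'_def by (rule bad_cycle_series[OF c])
  define I where "I K = {3..K} - {4::nat}" for K
  have I: "finite (I K)" "\<And>k. k \<in> I K \<Longrightarrow> 2 < k" for K by (auto simp: I_def)
  have sum_a: "(\<Sum>k\<in>I K. c ^ k / (2 * k)) = sum a {..<Suc K}" for K
  proof -
    have "(\<Sum>k\<in>I K. c ^ k / (2 * k)) = sum a (I K)"
      by (intro sum.cong) (auto simp: I_def a_def)
    also have "\<dots> = sum a {..<Suc K}"
      by (intro sum.mono_neutral_left) (auto simp: I_def a_def)
    finally show ?thesis .
  qed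
  define Q where "Q K n = bexp (all_pairs n) (c / n) (\<lambda>E. of_bool (avoids (cyc_sets {..<n} (I K)) E))" for K n
  have J: "finite (cyc_sets {..<n} (I K))" "\<And>F. F \<in> cyc_sets {..<n} (I K) \<Longrightarrow> F \<subseteq> all_pairs n" for n K
    using I by (auto simp: finite_cyc_sets dest: cyc_sets_subset_all_pairs)
  have prob: "gnp_prob n (c / real n) (\<lambda>E. \<not> has_bad_cycle E) = Q n n" for n
    unfolding gnp_prob_eq_bexp Q_def I_def by (intro bexp_cong) (simp add: has_bad_cycle_iff)
  have p: "0 \<le> c / real n" "c / real n < 1" "c / real n \<le> 1" if "0 < n" for n
  proof -
    have "1 \<le> real n" using that by simp
    then show "0 \<le> c / real n" "c / real n < 1" "c / real n \<le> 1" using c by (auto simp: divide_le_eq divide_less_eq)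
  qed
  \<comment> \<open>The expected number of bad cycles never exceeds -c', since at most n^k lists
    have length k. Every single cycle has probability at most c/n, so one common denominator 1 - c/n
    serves for all factors, and it tends to 1.\<close>
  have lower: "exp (- (- c' / (1 - c / n))) \<le> Q n n" if n: "0 < n" for n
  proof -
    note p = p[OF n]
    have "(\<Sum>F\<in>cyc_sets {..<n} (I n). (c / n) ^ card F) = (\<Sum>k\<in>I n. real (card (dlists {..<n} k)) / (2 * k) * (c / n) ^ k)"
      by (rule sum_cyc_sets) (use I in auto)
    also have "\<dots> \<le> (\<Sum>k\<in>I n. c ^ k / (2 * k))"
    proof (rule sum_mono)
      fix k assume "k \<in> I n"
      have "real (card (dlists {..<n} k)) * (c / n) ^ k \<le> real n ^ k * (c / n) ^ k"
        using p card_dlists_le[of n k] by (intro mult_right_mono) (auto simp flip: of_nat_power)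
      also have "\<dots> = c ^ k" using n by (simp add: power_divide)
      finally have "real (card (dlists {..<n} k)) * (c / n) ^ k / (2 * k) \<le> c ^ k / (2 * k)"
        by (rule divide_right_mono) simp
      then show "real (card (dlists {..<n} k)) / (2 * k) * (c / n) ^ k \<le> c ^ k / (2 * k)" by simp
    qed
    also have "\<dots> \<le> - c'"
      unfolding sum_a using sum_le_suminf[OF sums_summable[OF a_sums], of "{..<Suc n}"] a_nn sums_unique[OF a_sums] by simp
    finally have le: "(\<Sum>F\<in>cyc_sets {..<n} (I n). (c / n) ^ card F) \<le> - c'" .
    have "exp (- (- c' / (1 - c / n))) \<le> exp (- ((\<Sum>F\<in>cyc_sets {..<n} (I n). (c / n) ^ card F) / (1 - c / n)))"
      using p divide_right_mono[OF le, of "1 - c / n"] by simp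
    also have "\<dots> = (\<Prod>F\<in>cyc_sets {..<n} (I n). exp (- ((c / n) ^ card F / (1 - c / n))))"
      unfolding sum_divide_distrib sum_negf[symmetric] by (rule exp_sum[OF J(1)])
    also have "\<dots> \<le> (\<Prod>F\<in>cyc_sets {..<n} (I n). 1 - (c / n) ^ card F)"
    proof (rule prod_mono, safe)
      fix F assume "F \<in> cyc_sets {..<n} (I n)"
      then have "1 \<le> card F" using I(2)[of _ n] by (fastforce simp: cyc_sets_def dlists_def card_cyc_edges)
      then have "(c / n) ^ card F \<le> (c / n) ^ 1" using p by (intro power_decreasing) auto
      then show "exp (- ((c / n) ^ card F / (1 - c / n))) \<le> 1 - (c / n) ^ card F"
        using p by (intro one_minus_ge_exp) auto
    qed simp
    also have "\<dots> \<le> Q n n"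
      unfolding Q_def by (rule avoids_ge_prod) (use p J in auto)
    finally show ?thesis .
  qed
  \<comment> \<open>Janson's bound for cycles of length at most K, with the pair bound at
    \<open>card V * p = c\<close>. For fixed K its error term is a constant times 1/n; K is chosen
    further below according to the desired accuracy.\<close>
  define U where "U K n = exp (- (\<Sum>k\<in>I K. real (card (dlists {..<n} k)) / (2 * k) * (c / n) ^ k)
      + c / n * (Suc K * (2 * K + 1 + c) ^ K)\<^sup>2)" for K n :: nat
  have upper: "Q n n \<le> U K n" if n: "0 < n" "K \<le> n" for n K
  proof -
    note p = p[OF n(1)]
    have "Q n n \<le> Q K n"
      unfolding Q_def using p n by (intro bexp_mono) (auto simp: I_def cyc_sets_def avoids_def of_bool_def)
    also have "\<dots> \<le> exp (- (\<Sum>F\<in>cyc_sets {..<n} (I K). (c / n) ^ card F)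
      + (\<Sum>(F,G)\<in>{(F,G)\<in>cyc_sets {..<n} (I K) \<times> cyc_sets {..<n} (I K). F \<noteq> G \<and> F \<inter> G \<noteq> {}}. (c / n) ^ card (F \<union> G)))"
      unfolding Q_def by (rule Janson) (use p J in auto)
    also have "(\<Sum>F\<in>cyc_sets {..<n} (I K). (c / n) ^ card F) = (\<Sum>k\<in>I K. real (card (dlists {..<n} k)) / (2 * k) * (c / n) ^ k)"
      by (rule sum_cyc_sets) (use I in auto)
    finally show ?thesis
    proof (rule order_trans)
      show "exp (- (\<Sum>k\<in>I K. real (card (dlists {..<n} k)) / (2 * k) * (c / n) ^ k)
      + (\<Sum>(F,G)\<in>{(F,G)\<in>cyc_sets {..<n} (I K) \<times> cyc_sets {..<n} (I K). F \<noteq> G \<and> F \<inter> G \<noteq> {}}. (c / n) ^ card (F \<union> G))) \<le> U K n"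
        using sum_cyc_sets_pairs_le[of "{..<n}" "c / n" "I K" K] p n by (simp add: U_def I_def add_ac)
    qed
  qed
  have U_lim: "U K \<longlonglongrightarrow> exp (- sum a {..<Suc K})" for K
  proof -
    have "(\<lambda>n. - (\<Sum>k\<in>I K. real (card (dlists {..<n} k)) * (c / n) ^ k / (2 * k)) + c * (1 / real n) * (Suc K * (2 * K + 1 + c) ^ K)\<^sup>2)
      \<longlonglongrightarrow> - (\<Sum>k\<in>I K. c ^ k / (2 * k)) + c * 0 * (Suc K * (2 * K + 1 + c) ^ K)\<^sup>2"
      by (intro tendsto_intros card_dlists_times_tendsto lim_1_over_n) (auto simp: I_def)
    then have "(\<lambda>n. - (\<Sum>k\<in>I K. real (card (dlists {..<n} k)) / (2 * k) * (c / n) ^ k) + c / n * (Suc K * (2 * K + 1 + c) ^ K)\<^sup>2)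
      \<longlonglongrightarrow> - sum a {..<Suc K}"
      using sum_a[of K] by simp
    then show ?thesis unfolding U_def by (rule tendsto_exp)
  qed
  have "(\<lambda>n. Q n n) \<longlonglongrightarrow> exp c'"
  proof (rule order_tendstoI)
    fix y assume y: "y < exp c'"
    have "(\<lambda>n. exp (- (- c' / (1 - c * (1 / real n))))) \<longlonglongrightarrow> exp (- (- c' / (1 - c * 0)))"
      by (intro tendsto_intros lim_1_over_n) auto
    then have "(\<lambda>n. exp (- (- c' / (1 - c / real n)))) \<longlonglongrightarrow> exp c'" by simp
    from order_tendstoD(1)[OF this y] show "\<forall>\<^sub>F n in sequentially. y < Q n n"
      using eventually_gt_at_top[of 0]
    proof eventually_elim
      case (elim n)
      then show ?case using lower[of n] by linarith
    qed
  next
    fix y assume y: "exp c' < y"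
    have "(\<lambda>K. exp (- sum a {..<K})) \<longlonglongrightarrow> exp (- (- c'))"
      using a_sums unfolding sums_def by (intro tendsto_intros)
    then have "(\<lambda>K. exp (- sum a {..<Suc K})) \<longlonglongrightarrow> exp c'"
      by (subst filterlim_sequentially_Suc) simp
    then have "\<forall>\<^sub>F K in sequentially. exp (- sum a {..<Suc K}) < y"
      using y by (rule order_tendstoD(2))
    then obtain K where K: "exp (- sum a {..<Suc K}) < y"
      by (auto simp: eventually_sequentially)
    from order_tendstoD(2)[OF U_lim K] show "\<forall>\<^sub>F n in sequentially. Q n n < y"
      using eventually_ge_at_top[of "Suc K"]
    proof eventually_elim
      case (elim n)
      then show ?case using upper[of n K] by linarith
    qed
  qed
  then show ?thesis by (simp add: prob)
qed

section \<open>Bicyclic subgraphs\<close>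

definition path_edges :: "'a list \<Rightarrow> 'a set set" where
  "path_edges xs = (\<lambda>t. {xs ! t, xs ! Suc t}) ` {..<length xs - 1}"

definition bicycle_edges :: "'a list \<Rightarrow> nat \<Rightarrow> nat \<Rightarrow> 'a set set" where
  "bicycle_edges xs i j = path_edges xs \<union> {{xs ! 0, xs ! i}, {xs ! (length xs - 1), xs ! j}}"

text \<open>A path together with a chord at either end. When the two chords coincide the path merely closes
  up to a cycle; that case is excluded.\<close>

definition bicycle_index :: "nat \<Rightarrow> nat \<Rightarrow> nat \<Rightarrow> bool" where
  "bicycle_index s i j \<longleftrightarrow> 2 \<le> i \<and> i < s \<and> j + 2 < s \<and> \<not> (i = s - 1 \<and> j = 0)"

definition has_bicycle :: "'a set set \<Rightarrow> bool" where
  "has_bicycle E \<longleftrightarrow> (\<exists>xs i j. distinct xs \<and> bicycle_index (length xs) i j \<and> bicycle_edges xs i j \<subseteq> E)"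

lemma doubleton_in_all_pairs: "{x, y} \<in> all_pairs n \<longleftrightarrow> x < n \<and> y < n \<and> x \<noteq> y"
  by (auto simp: all_pairs_def doubleton_eq_iff)

text \<open>The path contributes s - 1 edges. The bounds on i and j keep either chord from joining
  consecutive vertices, and the excluded case is the only one in which the chords coincide.\<close>

lemma card_bicycle_edges:
  assumes "distinct xs" "bicycle_index (length xs) i j"
  shows "card (bicycle_edges xs i j) = Suc (length xs)"
proof -
  let ?s = "length xs" and ?e = "{xs ! 0, xs ! i}" and ?f = "{xs ! (length xs - 1), xs ! j}"
  have ij: "2 \<le> i" "i < ?s" "j + 2 < ?s" "\<not> (i = ?s - 1 \<and> j = 0)" "0 < ?s" "?s - 1 < ?s" "j < ?s"
    using assms(2) by (auto simp: bicycle_index_def)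
  then have ne: "xs \<noteq> []" by auto
  have "inj_on (\<lambda>t. {xs ! t, xs ! Suc t}) {..<?s - 1}"
    using assms(1) by (auto simp: inj_on_def doubleton_eq_iff nth_eq_iff_index_eq)
  then have 1: "card (path_edges xs) = ?s - 1" by (simp add: path_edges_def card_image)
  have 2: "?e \<notin> path_edges xs"
    using assms(1) ij(1,2) ne by (auto simp: path_edges_def doubleton_eq_iff nth_eq_iff_index_eq)
  have 3: "?f \<notin> path_edges xs"
    using assms(1) ij(3) by (auto simp: path_edges_def doubleton_eq_iff nth_eq_iff_index_eq)
  have 4: "?e \<noteq> ?f"
  proof
    assume "?e = ?f"
    then have "xs ! 0 = xs ! (?s - 1) \<and> xs ! i = xs ! j \<or> xs ! 0 = xs ! j \<and> xs ! i = xs ! (?s - 1)"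
      by (simp add: doubleton_eq_iff)
    then show False using nth_eq_iff_index_eq[OF assms(1)] ij by (metis One_nat_def diff_is_0_eq add_2_eq_Suc' less_Suc_eq_le not_less_eq zero_less_Suc Suc_pred less_nat_zero_code add_lessD1)
  qed
  have fin: "finite (path_edges xs)" by (simp add: path_edges_def)
  have eq: "bicycle_edges xs i j = insert ?e (insert ?f (path_edges xs))" by (auto simp: bicycle_edges_def)
  show ?thesis unfolding eq using 1 2 3 4 fin ij by simp
qed

lemma bicycle_edges_set:
  assumes "distinct xs" "bicycle_index (length xs) i j" "bicycle_edges xs i j \<subseteq> E" "\<Union> E \<subseteq> V"
  shows "set xs \<subseteq> V"
proof
  fix x assume "x \<in> set xs"
  then obtain t where t: "t < length xs" "x = xs ! t" by (auto simp: in_set_conv_nth)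
  have l: "2 < length xs" using assms(2) by (auto simp: bicycle_index_def)
  have "\<exists>e\<in>path_edges xs. x \<in> e"
  proof (cases "Suc t < length xs")
    case True
    then show ?thesis using t by (auto simp: path_edges_def)
  next
    case False
    then have "t = Suc (t - 1)" "t - 1 < length xs - 1" using t l by auto
    then have "x \<in> {xs ! (t - 1), xs ! Suc (t - 1)}" "{xs ! (t - 1), xs ! Suc (t - 1)} \<in> path_edges xs"
      using t by (auto simp: path_edges_def)
    then show ?thesis by blast
  qed
  then show "x \<in> V" using assms by (auto simp: bicycle_edges_def)
qed

text \<open>The geometric series differentiated twice has coefficients (n + 1)(n + 2), which
  dominate n^2.\<close>

lemma summable_square_power:
  fixes c :: real
  assumes "0 < c" "c < 1"
  shows "summable (\<lambda>s. (real s)\<^sup>2 * c ^ s)"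
proof -
  have 1: "summable (\<lambda>n. diffs (\<lambda>_. 1) n * x ^ n)" if "norm x < 1" for x :: real
    by (rule termdiff_converges[OF that]) (simp add: summable_geometric)
  have "summable (\<lambda>n. diffs (diffs (\<lambda>_. 1)) n * c ^ n)"
    by (rule termdiff_converges[of _ 1]) (use assms 1 in auto)
  then show ?thesis
  proof (rule summable_comparison_test_ev[rotated])
    show "\<forall>\<^sub>F n in sequentially. norm ((real n)\<^sup>2 * c ^ n) \<le> diffs (diffs (\<lambda>_. 1)) n * c ^ n"
      using assms by (intro always_eventually allI) (auto simp: diffs_def power2_eq_square intro!: mult_mono)
  qed
qed

text \<open>The union bound, in first-moment form.\<close>

lemma bexp_Bex_le:
  assumes "finite S" "0 \<le> p" "p \<le> 1" "finite I" "\<And>i. i \<in> I \<Longrightarrow> F i \<subseteq> S"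
    and "\<And>A. A \<subseteq> S \<Longrightarrow> P A \<Longrightarrow> \<exists>i\<in>I. F i \<subseteq> A"
  shows "bexp S p (\<lambda>A. of_bool (P A)) \<le> (\<Sum>i\<in>I. p ^ card (F i))"
proof -
  have "bexp S p (\<lambda>A. of_bool (P A)) \<le> bexp S p (\<lambda>A. \<Sum>i\<in>I. of_bool (F i \<subseteq> A))"
  proof (rule bexp_mono[OF assms(2,3)])
    fix A assume A: "A \<subseteq> S"
    show "of_bool (P A) \<le> (\<Sum>i\<in>I. of_bool (F i \<subseteq> A) :: real)"
    proof (cases "P A")
      case True
      then obtain i where i: "i \<in> I" "F i \<subseteq> A" using assms(6)[OF A] by blast
      have "of_bool (F i \<subseteq> A) \<le> (\<Sum>i\<in>I. of_bool (F i \<subseteq> A) :: real)"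
        by (rule member_le_sum) (use i assms in auto)
      then show ?thesis using i True by simp
    qed (simp add: sum_nonneg)
  qed
  also have "\<dots> = (\<Sum>i\<in>I. p ^ card (F i))"
    unfolding bexp_sum using assms by (intro sum.cong) (auto simp: bexp_superset)
  finally show ?thesis .
qed

text \<open>For s vertices there are at most n^s lists and s^2 pairs of chords, each configuration
  having probability (c/n)^(s+1). This leaves s^2 c^(s+1) / n, which is summable over s because c <
  1.\<close>

lemma gnp_prob_bicycle_tendsto_0:
  fixes c :: real
  assumes c: "0 < c" "c < 1"
  shows "(\<lambda>n. gnp_prob n (c / real n) has_bicycle) \<longlonglongrightarrow> 0"
proof -
  define f where "f s = c * ((real s)\<^sup>2 * c ^ s)" for s
  have sf: "summable f" unfolding f_def by (intro summable_mult summable_square_power c)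
  have f_nn: "0 \<le> f s" for s using c by (simp add: f_def)
  have le: "gnp_prob n (c / n) has_bicycle \<le> suminf f * (1 / n)" if n: "0 < n" for n
  proof -
    have "1 \<le> real n" using n by simp
    then have p: "0 \<le> c / n" "c / n \<le> 1" using c by (auto simp: divide_le_eq)
    define P where "P s = {(i, j). i < s \<and> j < s \<and> bicycle_index s i j}" for s
    define I where "I = (SIGMA s:{..n}. dlists {..<n} s \<times> P s)"
    define F where "F = (\<lambda>(s::nat, xs :: nat list, i, j). bicycle_edges xs i j)"
    have P_sub: "P s \<subseteq> {..<s} \<times> {..<s}" for s by (auto simp: P_def)
    have fin: "finite (P s)" for s by (rule finite_subset[OF P_sub]) auto
    have finI: "finite I" unfolding I_def by (intro finite_SigmaI finite_cartesian_product fin finite_dlists) auto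
    have "gnp_prob n (c / n) has_bicycle \<le> (\<Sum>x\<in>I. (c / n) ^ card (F x))"
      unfolding gnp_prob_eq_bexp
    proof (rule bexp_Bex_le[OF _ p finI])
      fix x assume "x \<in> I"
      then obtain s xs i j where x: "x = (s, xs, i, j)" "length xs = s" "distinct xs" "set xs \<subseteq> {..<n}" "bicycle_index s i j"
        by (auto simp: I_def P_def dlists_def)
      have ne: "{xs ! a, xs ! b} \<in> all_pairs n" if "a < s" "b < s" "a \<noteq> b" for a b
        using that x subsetD[OF x(4) nth_mem, of a] subsetD[OF x(4) nth_mem, of b] by (auto simp: doubleton_in_all_pairs nth_eq_iff_index_eq)
      show "F x \<subseteq> all_pairs n"
        using x(2,5) by (auto simp: F_def x(1) bicycle_edges_def path_edges_def bicycle_index_def intro!: ne)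
    next
      fix E assume E: "E \<subseteq> all_pairs n" "has_bicycle E"
      then obtain xs i j where xs: "distinct xs" "bicycle_index (length xs) i j" "bicycle_edges xs i j \<subseteq> E"
        by (auto simp: has_bicycle_def)
      have "set xs \<subseteq> {..<n}"
        by (rule bicycle_edges_set[OF xs]) (use E in \<open>auto simp: all_pairs_eq\<close>)
      moreover from this have "length xs \<le> n"
        using xs(1) card_mono[of "{..<n}" "set xs"] by (simp add: distinct_card)
      ultimately have "(length xs, xs, i, j) \<in> I"
        using xs by (auto simp: I_def P_def dlists_def bicycle_index_def)
      then show "\<exists>x\<in>I. F x \<subseteq> E" using xs by (auto simp: F_def intro!: bexI)
    qed simp
    also have "\<dots> = (\<Sum>s\<le>n. \<Sum>y\<in>dlists {..<n} s \<times> P s. (c / n) ^ card (F (s, y)))"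
      unfolding I_def by (subst sum.Sigma) (auto intro: fin finite_dlists)
    also have "\<dots> \<le> (\<Sum>s\<le>n. f s * (1 / n))"
    proof (rule sum_mono)
      fix s assume "s \<in> {..n}"
      have "card (P s) \<le> card ({..<s} \<times> {..<s})"
        by (rule card_mono[OF _ P_sub]) auto
      then have crd: "real (card (P s)) \<le> (real s)\<^sup>2"
        by (simp add: card_cartesian_product power2_eq_square flip: of_nat_mult)
      have "(\<Sum>y\<in>dlists {..<n} s \<times> P s. (c / n) ^ card (F (s, y))) = (\<Sum>y\<in>dlists {..<n} s \<times> P s. (c / n) ^ Suc s)"
        by (rule sum.cong) (auto simp: F_def dlists_def P_def card_bicycle_edges)
      also have "\<dots> = card (dlists {..<n} s) * (card (P s) * (c / n) ^ Suc s)"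
        by (simp add: card_cartesian_product)
      also have "\<dots> \<le> real n ^ s * ((real s)\<^sup>2 * (c / n) ^ Suc s)"
        using crd card_dlists_le[of n s] p c by (intro mult_mono) (auto simp flip: of_nat_power)
      also have "\<dots> = f s * (1 / n)"
        using n by (simp add: f_def power_divide field_simps)
      finally show "(\<Sum>y\<in>dlists {..<n} s \<times> P s. (c / n) ^ card (F (s, y))) \<le> f s * (1 / n)" .
    qed
    also have "\<dots> = (\<Sum>s\<le>n. f s) * (1 / n)" by (rule sum_distrib_right[symmetric])
    also have "\<dots> \<le> suminf f * (1 / n)"
      by (intro mult_right_mono sum_le_suminf[OF sf]) (auto simp: f_nn)
    finally show ?thesis .
  qed
  show ?thesis
  proof (rule tendsto_sandwich[of "\<lambda>_. 0" _ _ "\<lambda>n. suminf f * (1 / real n)"])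
    have "(\<lambda>n. suminf f * (1 / real n)) \<longlonglongrightarrow> suminf f * 0"
      by (intro tendsto_intros lim_1_over_n)
    then show "(\<lambda>n. suminf f * (1 / real n)) \<longlonglongrightarrow> 0" by simp
    show "\<forall>\<^sub>F n in sequentially. gnp_prob n (c / n) has_bicycle \<le> suminf f * (1 / n)"
      using eventually_gt_at_top[of 0] by eventually_elim (rule le)
    show "\<forall>\<^sub>F n in sequentially. 0 \<le> gnp_prob n (c / n) has_bicycle"
      using eventually_gt_at_top[of 0]
    proof eventually_elim
      case (elim n)
      then have "1 \<le> real n" by simp
      then show ?case unfolding gnp_prob_eq_bexp using c by (intro bexp_nonneg) (auto simp: divide_le_eq)
    qed
  qed simp
qed

text \<open>Without edges there is no nontrivial loop, so this event has to be negligible for the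
  second limit.\<close>

lemma gnp_prob_empty_tendsto_0:
  fixes c :: real
  assumes c: "0 < c" "c < 1"
  shows "(\<lambda>n. gnp_prob n (c / real n) (\<lambda>E. E = {})) \<longlonglongrightarrow> 0"
proof (rule tendsto_sandwich)
  have eq: "gnp_prob n p (\<lambda>E. E = {}) = (1 - p) ^ (n choose 2)" for n p
  proof -
    have "(\<Sum>E\<in>Pow (all_pairs n). if E = {} then p ^ card E * (1 - p) ^ (card (all_pairs n) - card E) else 0)
        = (if {} \<in> Pow (all_pairs n) then p ^ card ({} :: nat set set) * (1 - p) ^ (card (all_pairs n) - card ({} :: nat set set)) else 0)"
      by (rule sum.delta) simp
    then show ?thesis by (simp add: gnp_prob_def card_all_pairs)
  qed
  have p: "0 \<le> c / n" "c / n \<le> 1" if "0 < n" for n :: nat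
  proof -
    have "1 \<le> real n" using that by simp
    then show "0 \<le> c / n" "c / n \<le> 1" using c by (auto simp: divide_le_eq)
  qed
  show "\<forall>\<^sub>F n in sequentially. 0 \<le> gnp_prob n (c / n) (\<lambda>E. E = {})"
    using eventually_gt_at_top[of 0] by eventually_elim (use p in \<open>simp add: eq\<close>)
  show "\<forall>\<^sub>F n in sequentially. gnp_prob n (c / n) (\<lambda>E. E = {}) \<le> exp (- (c / 2 * (real n - 1)))"
    using eventually_gt_at_top[of 0]
  proof eventually_elim
    case (elim n)
    have ch: "real (n choose 2) = real n * (real n - 1) / 2"
      using elim by (simp add: choose_two real_of_nat_div of_nat_diff)
    have "(1 - c / n) ^ (n choose 2) \<le> exp (- (c / n)) ^ (n choose 2)"
      using exp_ge_add_one_self[of "- (c / n)"] p[OF elim] by (intro power_mono) auto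
    also have "\<dots> = exp (- (c / 2 * (real n - 1)))"
      using elim by (simp add: exp_of_nat_mult[symmetric] ch field_simps)
    finally show ?case by (simp add: eq)
  qed
  have "(\<lambda>n. exp (c / 2) * exp (- (c / 2)) ^ n) \<longlonglongrightarrow> exp (c / 2) * 0"
    using c by (intro tendsto_intros LIMSEQ_power_zero) auto
  moreover have "exp (c / 2) * exp (- (c / 2)) ^ n = exp (- (c / 2 * (real n - 1)))" for n
    by (simp add: exp_of_nat_mult[symmetric] exp_add[symmetric] field_simps)
  ultimately show "(\<lambda>n. exp (- (c / 2 * (real n - 1)))) \<longlonglongrightarrow> 0" by simp
qed simp

section \<open>Graphs without bicyclic subgraphs\<close>

text \<open>The neighbourhood in the subgraph induced on W. Vertices are removed by shrinking W
  while E stays fixed, so the absence of bicycles and bad cycles is inherited for free.\<close>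

definition nb :: "'a set set \<Rightarrow> 'a set \<Rightarrow> 'a \<Rightarrow> 'a set" where
  "nb E W v = {w \<in> W. {v, w} \<in> E}"

lemma path_edges_Cons: "xs \<noteq> [] \<Longrightarrow> path_edges (a # xs) \<subseteq> insert {a, xs ! 0} (path_edges xs)"
proof
  fix e assume ne: "xs \<noteq> []" and "e \<in> path_edges (a # xs)"
  then obtain t where t: "t < length xs" "e = {(a # xs) ! t, xs ! t}" by (auto simp: path_edges_def)
  show "e \<in> insert {a, xs ! 0} (path_edges xs)"
  proof (cases t)
    case (Suc u)
    then have "e = {xs ! u, xs ! Suc u}" "u < length xs - 1" using t by auto
    then show ?thesis by (auto simp: path_edges_def)
  qed (use t in auto)
qed

lemma path_edges_rev: "path_edges (rev xs) = path_edges xs"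
proof -
  have sub: "path_edges (rev xs) \<subseteq> path_edges xs" for xs :: "'a list"
  proof
    fix e assume "e \<in> path_edges (rev xs)"
    then obtain t where t: "t < length xs - 1" "e = {rev xs ! t, rev xs ! Suc t}" by (auto simp: path_edges_def)
    define u where "u = length xs - Suc (Suc t)"
    have u: "u < length xs - 1" "length xs - Suc t = Suc u" using t(1) by (auto simp: u_def)
    have "e = {xs ! Suc u, xs ! u}" using t u by (simp add: rev_nth flip: u_def)
    then show "e \<in> path_edges xs" using u by (auto simp: path_edges_def)
  qed
  from sub[of xs] sub[of "rev xs"] show ?thesis by simp
qed

lemma cyc_edges_eq_path_edges:
  assumes "xs \<noteq> []"
  shows "cyc_edges xs = insert {xs ! 0, xs ! (length xs - 1)} (path_edges xs)"
proof -
  have "{..<length xs} = insert (length xs - 1) {..<length xs - 1}" using assms by (cases xs) auto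
  then have "cyc_edges xs = insert {xs ! (length xs - 1), xs ! (Suc (length xs - 1) mod length xs)}
    ((\<lambda>t. {xs ! t, xs ! (Suc t mod length xs)}) ` {..<length xs - 1})"
    by (simp add: cyc_edges_def)
  moreover have "(\<lambda>t. {xs ! t, xs ! (Suc t mod length xs)}) ` {..<length xs - 1} = path_edges xs"
    unfolding path_edges_def by (intro image_cong) auto
  ultimately show ?thesis using assms by (simp add: insert_commute)
qed

text \<open>On a longest path through \<open>v\<close>, an end vertex has all its neighbours on the path; as there is no
  bicycle, the path must close up to a cycle all of whose rotations are again longest paths.\<close>

lemma cycle_through_vertex:
  assumes fin: "finite W" and loopless: "\<And>v. {v} \<notin> E" and deg: "\<And>v. v \<in> W \<Longrightarrow> 2 \<le> card (nb E W v)"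
    and nobic: "\<not> has_bicycle E" and v: "v \<in> W"
  obtains xs where "distinct xs" "2 < length xs" "set xs \<subseteq> W" "xs ! 0 = v" "cyc_edges xs \<subseteq> E"
    "nb E W v = {xs ! 1, xs ! (length xs - 1)}"
proof -
  \<comment> \<open>Only paths through v compete, so the longest one is certain to contain
    v.\<close>
  define P where "P xs \<longleftrightarrow> distinct xs \<and> set xs \<subseteq> W \<and> v \<in> set xs \<and> path_edges xs \<subseteq> E" for xs
  have Pv: "P [v]" using v by (auto simp: P_def path_edges_def)
  have bound: "length xs \<le> card W" if "P xs" for xs
    using that fin card_mono[of W "set xs"] by (auto simp: P_def distinct_card)
  obtain xs where xs: "P xs" and max: "\<And>ys. P ys \<Longrightarrow> length ys \<le> length xs"
    using ex_has_greatest_nat[of P "[v]" length "Suc (card W)"] Pv bound by (meson le_imp_less_Suc)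
  define s where "s = length xs"
  have first: "nb E W (ys ! 0) \<subseteq> {ys ! i | i. 1 \<le> i \<and> i < s}" if ys: "P ys" "length ys = s" for ys
  proof
    fix w assume w: "w \<in> nb E W (ys ! 0)"
    have ne: "ys \<noteq> []" using ys by (auto simp: P_def)
    have "w \<in> set ys"
    proof (rule ccontr)
      assume "w \<notin> set ys"
      then have "P (w # ys)"
        using ys w path_edges_Cons[OF ne, of w] by (auto simp: P_def nb_def insert_commute)
      then show False using max[of "w # ys"] ys by (simp add: s_def)
    qed
    then obtain i where i: "i < s" "w = ys ! i" using ys by (auto simp: in_set_conv_nth)
    moreover have "i \<noteq> 0" using w i loopless[of "ys ! 0"] by (auto simp: nb_def intro!: gr0I)
    ultimately show "w \<in> {ys ! i | i. 1 \<le> i \<and> i < s}" by auto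
  qed
  \<comment> \<open>The first vertex has two neighbours, all on the path, and at most one of them is
    the next vertex.\<close>
  have chord: "\<exists>i. 2 \<le> i \<and> i < s \<and> {ys ! 0, ys ! i} \<in> E" if ys: "P ys" "length ys = s" for ys
  proof (rule ccontr)
    assume neg: "\<not> ?thesis"
    have "nb E W (ys ! 0) \<subseteq> {ys ! 1}"
    proof
      fix w assume w: "w \<in> nb E W (ys ! 0)"
      then obtain i where "1 \<le> i" "i < s" "w = ys ! i" using first[OF ys] by blast
      moreover from this have "\<not> 2 \<le> i" using neg w by (auto simp: nb_def)
      ultimately show "w \<in> {ys ! 1}" by (cases "i = 1") auto
    qed
    then have "card (nb E W (ys ! 0)) \<le> 1" using card_mono[of "{ys ! 1}"] by simp
    moreover have "ys ! 0 \<in> W" using ys by (cases ys) (auto simp: P_def)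
    ultimately show False using deg[of "ys ! 0"] by simp
  qed
  have closed: "2 < s \<and> {ys ! 0, ys ! (s - 1)} \<in> E \<and> nb E W (ys ! 0) = {ys ! 1, ys ! (s - 1)}"
    if ys: "P ys" "length ys = s" for ys
  proof -
    have "P (rev ys)" using ys by (simp add: P_def path_edges_rev)
    then obtain i' where i': "2 \<le> i'" "i' < s" "{rev ys ! 0, rev ys ! i'} \<in> E"
      using chord[of "rev ys"] ys by auto
    define j where "j = s - 1 - i'"
    have j: "j + 2 < s" "{ys ! (s - 1), ys ! j} \<in> E"
      using i' ys by (auto simp: j_def rev_nth)
    \<comment> \<open>A chord at the start and the chord at the far end form a bicycle unless they
      are the same edge, which is then the edge closing the path.\<close>
    have only: "i = s - 1 \<and> j = 0" if "2 \<le> i" "i < s" "{ys ! 0, ys ! i} \<in> E" for i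
    proof (rule ccontr)
      assume "\<not> ?thesis"
      then have "bicycle_index (length ys) i j" using that j ys by (auto simp: bicycle_index_def)
      moreover have "bicycle_edges ys i j \<subseteq> E" using ys that j by (auto simp: bicycle_edges_def P_def)
      ultimately show False using nobic ys by (auto simp: has_bicycle_def P_def)
    qed
    obtain i where i: "2 \<le> i" "i < s" "{ys ! 0, ys ! i} \<in> E" using chord[OF ys] by blast
    have last: "{ys ! 0, ys ! (s - 1)} \<in> E" using only[OF i] i by auto
    have sub: "nb E W (ys ! 0) \<subseteq> {ys ! 1, ys ! (s - 1)}"
    proof
      fix w assume w: "w \<in> nb E W (ys ! 0)"
      then obtain k where k: "1 \<le> k" "k < s" "w = ys ! k" using first[OF ys] by blast
      show "w \<in> {ys ! 1, ys ! (s - 1)}"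
      proof (cases "k = 1")
        case False
        then show ?thesis using only[of k] k w by (auto simp: nb_def)
      qed (use k in simp)
    qed
    have s2: "2 < s" using j by simp
    have "Suc 0 < length ys" "s - 1 < length ys" using s2 ys by auto
    then have W: "ys ! 1 \<in> W" "ys ! (s - 1) \<in> W" using ys nth_mem[of 1 ys] nth_mem[of "s - 1" ys] by (auto simp: P_def)
    have "{ys ! 0, ys ! Suc 0} \<in> path_edges ys" unfolding path_edges_def
      by (rule image_eqI[of _ _ 0]) (use s2 ys in auto)
    then have "{ys ! 0, ys ! 1} \<in> E" using ys by (auto simp: P_def)
    then show ?thesis using sub last W s2 by (auto simp: nb_def)
  qed
  have s2: "2 < s" using closed[OF xs] by (simp add: s_def)
  have cyc: "cyc_edges xs \<subseteq> E"
    using closed[OF xs] xs by (subst cyc_edges_eq_path_edges) (auto simp: P_def s_def)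
  obtain r where r: "r < s" "xs ! r = v" using xs by (auto simp: P_def in_set_conv_nth s_def)
  define ys where "ys = rotate r xs"
  have ys: "length ys = s" "ys ! 0 = v" "cyc_edges ys \<subseteq> E" "distinct ys" "set ys = set xs"
    using r s2 cyc xs nth_rotate[of 0 xs r] by (auto simp: ys_def s_def cyc_edges_rotate P_def simp del: length_greater_0_conv)
  moreover have "ys \<noteq> []" using ys(1) s2 by auto
  ultimately have "P ys" using xs cyc_edges_eq_path_edges[of ys] by (auto simp: P_def)
  then have "nb E W v = {ys ! 1, ys ! (s - 1)}" using closed[of ys] ys by simp
  then show thesis using that[of ys] ys s2 xs by (auto simp: P_def)
qed

section \<open>Dismantling\<close>

text \<open>If all degrees are at least two, v lies on a cycle that contains all its neighbours. The
  cycle has length 4, and the vertex opposite to v is adjacent to both neighbours of v, so v folds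
  onto it.\<close>

lemma dismantle_step:
  assumes "finite W" "W \<noteq> {}" "\<And>v. {v} \<notin> E" "\<not> has_bicycle E" "\<not> has_bad_cycle E"
  shows "\<exists>x\<in>W. card (nb E W x) \<le> 1 \<or> (\<exists>y\<in>W. y \<noteq> x \<and> nb E W x \<subseteq> nb E W y)"
proof (rule ccontr)
  assume neg: "\<not> ?thesis"
  obtain v where v: "v \<in> W" using assms by auto
  have deg: "2 \<le> card (nb E W v)" if "v \<in> W" for v
  proof -
    have "\<not> card (nb E W v) \<le> 1" using that neg by blast
    then show ?thesis by simp
  qed
  obtain xs where xs: "distinct xs" "2 < length xs" "set xs \<subseteq> W" "xs ! 0 = v" "cyc_edges xs \<subseteq> E"
    "nb E W v = {xs ! 1, xs ! (length xs - 1)}"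
    by (rule cycle_through_vertex[OF assms(1,3) deg assms(4) v])
  have l: "length xs = 4" using xs assms(5) by (auto simp: has_bad_cycle_def)
  have "{xs ! 2, xs ! 1} \<in> cyc_edges xs" "{xs ! 2, xs ! 3} \<in> cyc_edges xs"
    using cyc_edges_nbr[OF xs(1,2), of 2] l by auto
  then have "{xs ! 2, xs ! 1} \<in> E" "{xs ! 2, xs ! 3} \<in> E" using xs by auto
  moreover have "xs ! 1 \<in> W" "xs ! 2 \<in> W" "xs ! 3 \<in> W"
    using xs(3) nth_mem[of 1 xs] nth_mem[of 2 xs] nth_mem[of 3 xs] l by auto
  ultimately have "nb E W v \<subseteq> nb E W (xs ! 2)" unfolding xs(6) l by (auto simp: nb_def)
  moreover have "xs ! 2 \<noteq> xs ! 0" using xs(1) l by (subst nth_eq_iff_index_eq) auto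
  ultimately show False using neg v xs(4) \<open>xs ! 2 \<in> W\<close> by blast
qed

text \<open>In case \<open>leaf\<close> the vertex u is merely the only candidate for a neighbour of
  x; it is arbitrary when x is isolated.\<close>

lemma dismantle_induct [consumes 4, case_names empty leaf fold]:
  assumes "finite W" "\<And>v. {v} \<notin> E" "\<not> has_bicycle E" "\<not> has_bad_cycle E"
    and "P {}"
    and "\<And>W x u. finite W \<Longrightarrow> x \<in> W \<Longrightarrow> nb E W x \<subseteq> {u} \<Longrightarrow> P (W - {x}) \<Longrightarrow> P W"
    and "\<And>W x y. finite W \<Longrightarrow> x \<in> W \<Longrightarrow> y \<in> W \<Longrightarrow> y \<noteq> x \<Longrightarrow> nb E W x \<subseteq> nb E W y \<Longrightarrow> P (W - {x}) \<Longrightarrow> P W"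
  shows "P W"
  using assms(1)
proof (induction W rule: finite_psubset_induct)
  case (psubset W)
  show ?case
  proof (cases "W = {}")
    case False
    obtain x where x: "x \<in> W" "card (nb E W x) \<le> 1 \<or> (\<exists>y\<in>W. y \<noteq> x \<and> nb E W x \<subseteq> nb E W y)"
      using dismantle_step[OF psubset.hyps False assms(2-4)] by blast
    have IH: "P (W - {x})" using psubset.IH[of "W - {x}"] x by blast
    from x(2) show ?thesis
    proof
      assume c: "card (nb E W x) \<le> 1"
      have "finite (nb E W x)" using psubset.hyps by (simp add: nb_def)
      then obtain u where "nb E W x \<subseteq> {u}"
        using c by (metis One_nat_def card_le_Suc0_iff_eq subsetI singleton_iff)
      then show ?thesis using assms(6)[OF psubset.hyps x(1) _ IH] by blast
    next
      assume "\<exists>y\<in>W. y \<noteq> x \<and> nb E W x \<subseteq> nb E W y"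
      then show ?thesis using assms(7)[OF psubset.hyps x(1) _ _ _ IH] by blast
    qed
  qed (simp add: assms)
qed

text \<open>A leaf returns on the side opposite to its neighbour, a folded vertex on the side of the
  vertex onto which it folds.\<close>

lemma bipartite_if_no_bad_cycle:
  assumes "finite W" "\<And>v. {v} \<notin> E" "\<not> has_bicycle E" "\<not> has_bad_cycle E"
  shows "\<exists>s :: 'a \<Rightarrow> bool. \<forall>u\<in>W. \<forall>w\<in>W. {u, w} \<in> E \<longrightarrow> s u \<noteq> s w"
  using assms
proof (induction W rule: dismantle_induct)
  case (leaf W x u)
  then obtain s :: "'a \<Rightarrow> bool" where s: "\<forall>u\<in>W - {x}. \<forall>w\<in>W - {x}. {u, w} \<in> E \<longrightarrow> s u \<noteq> s w" by blast
  have nbx: "w = u" if "w \<in> W" "{x, w} \<in> E \<or> {w, x} \<in> E" for w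
    using leaf(3) that by (auto simp: nb_def insert_commute)
  show ?case
  proof (intro exI[of _ "s(x := \<not> s u)"] ballI impI)
    fix a b assume ab: "a \<in> W" "b \<in> W" "{a, b} \<in> E"
    have "a \<noteq> b" using ab assms(2)[of a] by auto
    then consider "a = x" "b \<noteq> x" | "b = x" "a \<noteq> x" | "a \<noteq> x" "b \<noteq> x" by blast
    then show "(s(x := \<not> s u)) a \<noteq> (s(x := \<not> s u)) b"
    proof cases
      case 1
      then have "b = u" using nbx[of b] ab by blast
      then show ?thesis using 1 by simp
    next
      case 2
      then have "a = u" using nbx[of a] ab by blast
      then show ?thesis using 2 by simp
    next
      case 3
      then show ?thesis using s ab by simp
    qed
  qed
next
  case (fold W x y)
  then obtain s :: "'a \<Rightarrow> bool" where s: "\<forall>u\<in>W - {x}. \<forall>w\<in>W - {x}. {u, w} \<in> E \<longrightarrow> s u \<noteq> s w" by blast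
  have nbx: "{y, w} \<in> E \<and> {w, y} \<in> E" if "w \<in> W" "{x, w} \<in> E \<or> {w, x} \<in> E" for w
    using fold(5) that by (auto simp: nb_def insert_commute)
  show ?case
  proof (intro exI[of _ "s(x := s y)"] ballI impI)
    fix a b assume ab: "a \<in> W" "b \<in> W" "{a, b} \<in> E"
    have "a \<noteq> b" using ab assms(2)[of a] by auto
    then consider "a = x" "b \<noteq> x" | "b = x" "a \<noteq> x" | "a \<noteq> x" "b \<noteq> x" by blast
    then show "(s(x := s y)) a \<noteq> (s(x := s y)) b"
    proof cases
      case 1
      then have "{y, b} \<in> E" using nbx[of b] ab by blast
      then have "s y \<noteq> s b" using s 1 ab fold(3,4) by blast
      then show ?thesis using 1 by simp
    next
      case 2
      then have "{a, y} \<in> E" using nbx[of a] ab by blast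
      then have "s a \<noteq> s y" using s 2 ab fold(3,4) by blast
      then show ?thesis using 2 by simp
    next
      case 3
      then show ?thesis using s ab by simp
    qed
  qed
qed simp

section \<open>Three-colourings and recolouring moves\<close>

definition proper :: "'a set set \<Rightarrow> 'a set \<Rightarrow> ('a \<Rightarrow> nat) \<Rightarrow> bool" where
  "proper E W \<phi> \<longleftrightarrow> (\<forall>v\<in>W. \<phi> v < 3) \<and> (\<forall>u\<in>W. \<forall>w\<in>W. {u, w} \<in> E \<longrightarrow> \<phi> u \<noteq> \<phi> w)"

text \<open>The vertex v may lie outside W, where colours are unconstrained; end points of sequences
  of moves are therefore compared on W only.\<close>

definition recolour :: "'a set set \<Rightarrow> 'a set \<Rightarrow> ('a \<Rightarrow> nat) \<Rightarrow> ('a \<Rightarrow> nat) \<Rightarrow> bool" where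
  "recolour E W \<phi> \<phi>' \<longleftrightarrow> proper E W \<phi> \<and> proper E W \<phi>' \<and> (\<exists>v. \<forall>u. u \<noteq> v \<longrightarrow> \<phi> u = \<phi>' u)"

lemma proper_cong: "(\<And>v. v \<in> W \<Longrightarrow> \<phi> v = \<phi>' v) \<Longrightarrow> proper E W \<phi> = proper E W \<phi>'"
  by (simp add: proper_def)

lemma proper_subset: "proper E W \<phi> \<Longrightarrow> W' \<subseteq> W \<Longrightarrow> proper E W' \<phi>"
  unfolding proper_def by blast

lemma proper_fun_upd_iff:
  assumes "\<And>v. {v} \<notin> E" "x \<in> W"
  shows "proper E W (\<phi>(x := c)) \<longleftrightarrow> proper E (W - {x}) \<phi> \<and> c < 3 \<and> (\<forall>w\<in>nb E W x. \<phi> w \<noteq> c)"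
proof -
  have "{w, x} = {x, w}" for w by auto
  moreover have "{x, x} \<notin> E" using assms(1)[of x] by simp
  ultimately show ?thesis using assms(2) unfolding proper_def nb_def
    by (auto split: if_splits)
qed

lemma third_colour: "\<exists>c<3. c \<noteq> (a::nat) \<and> c \<noteq> b"
proof -
  have "\<not> {0, 1, 2} \<subseteq> {a, b}" using card_mono[of "{a, b}" "{0, 1, 2::nat}"] by (auto simp: card_insert_if split: if_splits)
  then obtain c where "c \<in> {0, 1, 2}" "c \<notin> {a, b}" by blast
  then show ?thesis by (intro exI[of _ c]) auto
qed

text \<open>A sequence of moves on W without x is lifted to W. A leaf x steps out of the way before
  its neighbour moves; a folded x imitates y, following one move behind. A last move gives x its
  prescribed colour.\<close>

lemma recolour_connected:
  assumes "finite W" "\<And>v. {v} \<notin> E" "\<not> has_bicycle E" "\<not> has_bad_cycle E"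
  shows "proper E W \<phi> \<Longrightarrow> proper E W \<phi>' \<Longrightarrow> \<exists>\<phi>''. (recolour E W)\<^sup>*\<^sup>* \<phi> \<phi>'' \<and> (\<forall>w\<in>W. \<phi>'' w = \<phi>' w)"
  using assms
proof (induction W arbitrary: \<phi> \<phi>' rule: dismantle_induct)
  case (leaf W x u)
  note upd = proper_fun_upd_iff[of E x W, OF assms(2) leaf(2)]
  have pW: "proper E (W - {x}) \<phi>" "proper E (W - {x}) \<phi>'" using leaf.prems by (auto intro: proper_subset)
  from leaf.IH[OF this] obtain \<phi>1 where \<phi>1: "(recolour E (W - {x}))\<^sup>*\<^sup>* \<phi> \<phi>1" "\<forall>w\<in>W - {x}. \<phi>1 w = \<phi>' w" by blast
  from \<phi>1(1) have "\<exists>c. (recolour E W)\<^sup>*\<^sup>* \<phi> (\<phi>1(x := c)) \<and> proper E W (\<phi>1(x := c))"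
  proof (induction rule: rtranclp_induct)
    case base
    then show ?case using leaf.prems by (intro exI[of _ "\<phi> x"]) simp
  next
    case (step \<phi>1 \<phi>2)
    then obtain c where c: "(recolour E W)\<^sup>*\<^sup>* \<phi> (\<phi>1(x := c))" "proper E W (\<phi>1(x := c))" by blast
    \<comment> \<open>A colour for x that avoids both the old and the new colour of its neighbour;
      three colours are just enough.\<close>
    obtain d where d: "d < 3" "d \<noteq> \<phi>1 u" "d \<noteq> \<phi>2 u" using third_colour by blast
    have p: "proper E W (\<phi>1(x := d))" "proper E W (\<phi>2(x := d))"
      using step(2) leaf(3) d unfolding upd by (auto simp: recolour_def)
    have "recolour E W (\<phi>1(x := c)) (\<phi>1(x := d))" using c p by (auto simp: recolour_def)
    moreover have "recolour E W (\<phi>1(x := d)) (\<phi>2(x := d))" using step(2) p by (auto simp: recolour_def)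
    ultimately show ?case using c p by (meson rtranclp.rtrancl_into_rtrancl)
  qed
  then obtain c where c: "(recolour E W)\<^sup>*\<^sup>* \<phi> (\<phi>1(x := c))" "proper E W (\<phi>1(x := c))" by blast
  have "proper E W (\<phi>1(x := \<phi>' x))"
    using leaf.prems \<phi>1(2) proper_cong[of W "\<phi>1(x := \<phi>' x)" \<phi>'] by auto
  then have "recolour E W (\<phi>1(x := c)) (\<phi>1(x := \<phi>' x))" using c by (auto simp: recolour_def)
  with c(1) have "(recolour E W)\<^sup>*\<^sup>* \<phi> (\<phi>1(x := \<phi>' x))" by (rule rtranclp.rtrancl_into_rtrancl[where r = "recolour E W"])
  moreover have "\<forall>w\<in>W. (\<phi>1(x := \<phi>' x)) w = \<phi>' w" using \<phi>1(2) by auto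
  ultimately show ?case by blast
next
  case (fold W x y)
  note upd = proper_fun_upd_iff[of E x W, OF assms(2) fold(2)]
  have ynb: "y \<notin> nb E W x" using fold(5) assms(2)[of y] by (auto simp: nb_def)
  have yW: "y \<in> W - {x}" using fold by auto
  have nbx: "w \<in> W - {x} \<and> {w, y} \<in> E" if "w \<in> nb E W x" for w
    using that fold(5) assms(2)[of x] by (auto simp: nb_def insert_commute)
  have pW: "proper E (W - {x}) \<phi>" "proper E (W - {x}) \<phi>'" using fold.prems by (auto intro: proper_subset)
  from fold.IH[OF this] obtain \<phi>1 where \<phi>1: "(recolour E (W - {x}))\<^sup>*\<^sup>* \<phi> \<phi>1" "\<forall>w\<in>W - {x}. \<phi>1 w = \<phi>' w" by blast
  have sync: "proper E W (\<psi>(x := \<psi> y))" if "proper E (W - {x}) \<psi>" for \<psi>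
    using that nbx yW unfolding upd by (auto simp: proper_def)
  from \<phi>1(1) have "(recolour E W)\<^sup>*\<^sup>* \<phi> (\<phi>1(x := \<phi>1 y))"
  proof (induction rule: rtranclp_induct)
    case base
    have "recolour E W \<phi> (\<phi>(x := \<phi> y))" using fold.prems sync[OF pW(1)] by (auto simp: recolour_def)
    then show ?case by blast
  next
    case (step \<phi>1 \<phi>2)
    obtain v where v: "\<forall>u. u \<noteq> v \<longrightarrow> \<phi>1 u = \<phi>2 u" and p: "proper E (W - {x}) \<phi>1" "proper E (W - {x}) \<phi>2"
      using step(2) by (auto simp: recolour_def)
    \<comment> \<open>While the move takes place x keeps the old colour of y. This is legal since
      the neighbours of x are neighbours of y: if y moves, they do not, and otherwise y keeps its
      colour.\<close>
    have "\<phi>2 w \<noteq> \<phi>1 y" if w: "w \<in> nb E W x" for w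
    proof (cases "v = y")
      case True
      then have "\<phi>2 w = \<phi>1 w" using v w ynb by metis
      then show ?thesis using p(1) nbx[OF w] yW by (auto simp: proper_def)
    next
      case False
      then have "\<phi>2 y = \<phi>1 y" using v by metis
      moreover have "\<phi>2 w \<noteq> \<phi>2 y" using p(2) nbx[OF w] yW unfolding proper_def by blast
      ultimately show ?thesis by simp
    qed
    then have m: "proper E W (\<phi>2(x := \<phi>1 y))" using p yW unfolding upd by (auto simp: proper_def)
    have "recolour E W (\<phi>1(x := \<phi>1 y)) (\<phi>2(x := \<phi>1 y))" using v m sync[OF p(1)] by (auto simp: recolour_def)
    moreover have "recolour E W (\<phi>2(x := \<phi>1 y)) (\<phi>2(x := \<phi>2 y))" using m sync[OF p(2)] by (auto simp: recolour_def)
    ultimately show ?case using step.IH by (meson rtranclp.rtrancl_into_rtrancl)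
  qed
  moreover have "recolour E W (\<phi>1(x := \<phi>1 y)) (\<phi>1(x := \<phi>' x))"
  proof -
    have p': "proper E W (\<phi>1(x := \<phi>' x))"
      using fold.prems \<phi>1(2) proper_cong[of W "\<phi>1(x := \<phi>' x)" \<phi>'] by auto
    then have "proper E (W - {x}) \<phi>1" unfolding upd by simp
    from sync[OF this] p' show ?thesis by (auto simp: recolour_def)
  qed
  ultimately have "(recolour E W)\<^sup>*\<^sup>* \<phi> (\<phi>1(x := \<phi>' x))" by (rule rtranclp.rtrancl_into_rtrancl[where r = "recolour E W"])
  moreover have "\<forall>w\<in>W. (\<phi>1(x := \<phi>' x)) w = \<phi>' w" using \<phi>1(2) by auto
  ultimately show ?case by blast
qed auto

section \<open>Extending a colouring from a cycle\<close>

lemma cycle_degrees: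
  assumes xs: "distinct xs" "2 < length xs" "cyc_edges xs \<subseteq> E" "set xs \<subseteq> W" "finite W" and v: "v \<in> set xs"
  shows "2 \<le> card (nb E W v)" and "card (nb E W v) \<le> 2 \<Longrightarrow> w \<in> nb E W v \<Longrightarrow> {v, w} \<in> cyc_edges xs"
proof -
  let ?k = "length xs"
  obtain t where t: "t < ?k" "v = xs ! t" using v by (auto simp: in_set_conv_nth)
  define a b where "a = xs ! (Suc t mod ?k)" and "b = xs ! (if t = 0 then ?k - 1 else t - 1)"
  have ab: "{v, a} \<in> cyc_edges xs" "{v, b} \<in> cyc_edges xs"
    using cyc_edges_nbr[OF xs(1,2) t(1)] by (auto simp: a_def b_def t(2))
  have "Suc t mod ?k < ?k" "(if t = 0 then ?k - 1 else t - 1) < ?k" "Suc t mod ?k \<noteq> (if t = 0 then ?k - 1 else t - 1)"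
    using xs(2) t(1) by (auto simp: Suc_mod_eq)
  then have "a \<noteq> b" using nth_eq_iff_index_eq[OF xs(1)] unfolding a_def b_def by blast
  have sub: "{a, b} \<subseteq> nb E W v"
    using ab xs Union_cyc_edges[of xs] by (fastforce simp: nb_def)
  have fin: "finite (nb E W v)" using xs(5) by (simp add: nb_def)
  show "2 \<le> card (nb E W v)" using card_mono[OF fin sub] \<open>a \<noteq> b\<close> by simp
  assume "card (nb E W v) \<le> 2" and w: "w \<in> nb E W v"
  then have "{a, b} = nb E W v" using \<open>a \<noteq> b\<close> by (intro card_seteq[OF fin sub]) auto
  then have "w \<in> {a, b}" using w by simp
  then show "{v, w} \<in> cyc_edges xs" using ab by blast
qed

text \<open>Vertices off the cycle with at most two neighbours are removed and later coloured
  greedily with the third colour. Such a vertex exists as long as W exceeds the cycle: otherwise all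
  degrees would be at least two, and the absence of bicycles would make them exactly two. When only
  the cycle is left, the same argument shows that it has no chords, so the given colouring is
  proper.\<close>

lemma extend_colouring_of_cycle:
  assumes xs: "distinct xs" "2 < length xs" "cyc_edges xs \<subseteq> E"
    and loopless: "\<And>v. {v} \<notin> E" and nobic: "\<not> has_bicycle E"
    and \<phi>: "\<And>v. \<phi> v < 3" "\<And>t. t < length xs \<Longrightarrow> \<phi> (xs ! t) \<noteq> \<phi> (xs ! (Suc t mod length xs))"
    and W: "finite W" "set xs \<subseteq> W"
  shows "\<exists>\<phi>'. proper E W \<phi>' \<and> (\<forall>w\<in>set xs. \<phi>' w = \<phi> w)"
  using W
proof (induction W rule: finite_psubset_induct)
  case (psubset W)
  have deg2: "card (nb E W v) \<le> 2" if "v \<in> W" "\<And>u. u \<in> W \<Longrightarrow> 2 \<le> card (nb E W u)" for v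
  proof (rule cycle_through_vertex[OF psubset.hyps loopless that(2) nobic that(1)])
    fix ys assume "nb E W v = {ys ! 1, ys ! (length ys - 1)}"
    then show "card (nb E W v) \<le> 2" by (simp add: card_insert_if)
  qed
  show ?case
  proof (cases "W = set xs")
    case True
    have deg: "2 \<le> card (nb E W u)" if "u \<in> W" for u
      using cycle_degrees(1)[OF xs psubset.prems psubset.hyps] that True by simp
    have "{u, w} \<in> cyc_edges xs" if "u \<in> W" "w \<in> W" "{u, w} \<in> E" for u w
      using cycle_degrees(2)[OF xs psubset.prems psubset.hyps] deg2[OF _ deg] that True by (auto simp: nb_def)
    then have "\<phi> u \<noteq> \<phi> w" if "u \<in> W" "w \<in> W" "{u, w} \<in> E" for u w
      using that \<phi>(2) by (fastforce simp: cyc_edges_def doubleton_eq_iff)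
    then have "proper E W \<phi>" using \<phi>(1) by (simp add: proper_def)
    then show ?thesis by blast
  next
    case False
    have "\<exists>v\<in>W - set xs. card (nb E W v) \<le> 2"
    proof (rule ccontr)
      assume neg: "\<not> ?thesis"
      have "2 \<le> card (nb E W u)" if "u \<in> W" for u
        using cycle_degrees(1)[OF xs psubset.prems psubset.hyps] that neg by (cases "u \<in> set xs") force+
      then show False using deg2 neg psubset.prems False by blast
    qed
    then obtain v where v: "v \<in> W" "v \<notin> set xs" "card (nb E W v) \<le> 2" by auto
    obtain \<phi>' where \<phi>': "proper E (W - {v}) \<phi>'" "\<forall>w\<in>set xs. \<phi>' w = \<phi> w"
      using psubset.IH[of "W - {v}"] v psubset.prems by blast
    have fin: "finite (nb E W v)" using psubset.hyps by (simp add: nb_def)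
    have "card (\<phi>' ` nb E W v) < card {..<3::nat}"
      using card_image_le[OF fin, of \<phi>'] v(3) by simp
    then have "\<not> {..<3} \<subseteq> \<phi>' ` nb E W v" using fin by (meson card_mono finite_imageI not_le)
    then obtain c where "c < 3" "c \<notin> \<phi>' ` nb E W v" by auto
    then have "proper E W (\<phi>'(v := c))"
      using \<phi>' v(1) loopless by (subst proper_fun_upd_iff) auto
    moreover have "\<forall>w\<in>set xs. (\<phi>'(v := c)) w = \<phi> w" using \<phi>'(2) v(2) by auto
    ultimately show ?thesis by blast
  qed
qed

section \<open>The topology of Hom(G, \<open>K\<^sub>3\<close>)\<close>

abbreviation HomK3 :: "nat \<Rightarrow> nat set set \<Rightarrow> (nat \<times> nat \<Rightarrow> real) set" where
  "HomK3 n E \<equiv> hom_set n E K3_V K3_E"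

lemma hom_top_K3: "hom_top n E K3_V K3_E = top_of_set (HomK3 n E)"
  by (simp add: hom_top_def euclidean_product_topology)

text \<open>Distinct colours are always adjacent in the triangle, so the cell condition just says
  that adjacent vertices have disjoint supports.\<close>

lemma in_HomK3_iff:
  "f \<in> HomK3 n E \<longleftrightarrow> (\<forall>v i. 0 \<le> f (v, i)) \<and> (\<forall>v i. n \<le> v \<or> 3 \<le> i \<longrightarrow> f (v, i) = 0) \<and>
     (\<forall>v<n. f (v, 0) + f (v, 1) + f (v, 2) = 1) \<and>
     (\<forall>x y i. {x, y} \<in> E \<longrightarrow> f (x, i) = 0 \<or> f (y, i) = 0)"
  (is "?L \<longleftrightarrow> ?R")
proof -
  have V: "i \<notin> K3_V \<longleftrightarrow> 3 \<le> i" for i by (auto simp: K3_V_def)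
  have E3: "{i, j} \<in> K3_E \<longleftrightarrow> i < 3 \<and> j < 3 \<and> i \<noteq> j" for i j
    by (simp add: K3_E_def doubleton_in_all_pairs)
  have s: "(\<Sum>i\<in>K3_V. f (v, i)) = f (v, 0) + f (v, 1) + f (v, 2)" for v by (simp add: K3_V_def)
  show ?thesis
  proof
    assume L: ?L
    then have 1: "\<forall>v i. 0 \<le> f (v, i)" "\<forall>v i. n \<le> v \<or> 3 \<le> i \<longrightarrow> f (v, i) = 0"
      "\<forall>v<n. f (v, 0) + f (v, 1) + f (v, 2) = 1"
      using V s by (simp_all add: hom_set_def)
    have "f (x, i) = 0 \<or> f (y, i) = 0" if "{x, y} \<in> E" for x y i
    proof (rule ccontr)
      assume "\<not> ?thesis"
      then have "0 < f (x, i)" "0 < f (y, i)" using 1(1) by (auto simp: less_le)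
      then have "{i, i} \<in> K3_E" using L that unfolding hom_set_def by blast
      then show False using E3[of i i] by simp
    qed
    then show ?R using 1 by blast
  next
    assume R: ?R
    have "{i, j} \<in> K3_E" if "{x, y} \<in> E" "0 < f (x, i)" "0 < f (y, j)" for x y i j
    proof -
      have "i < 3" using R that(2) by (metis not_le order_less_irrefl)
      moreover have "j < 3" using R that(3) by (metis not_le order_less_irrefl)
      moreover have "i \<noteq> j" using R that by (metis order_less_irrefl)
      ultimately show ?thesis by (simp add: E3)
    qed
    then show ?L using R V s by (auto simp: hom_set_def)
  qed
qed

subsection \<open>Recolouring as paths\<close>

text \<open>The hypothesis \<open>fg\<close> says that the supports of f and g together form a cell;
  cells are convex, so the straight segment stays in the space.\<close>

lemma path_component_of_segment:
  assumes f: "f \<in> HomK3 n E" and g: "g \<in> HomK3 n E"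
    and fg: "\<And>x y i. {x, y} \<in> E \<Longrightarrow> f (x, i) = 0 \<and> g (x, i) = 0 \<or> f (y, i) = 0 \<and> g (y, i) = 0"
  shows "path_component_of (top_of_set (HomK3 n E)) f g"
proof -
  define h where "h t = (\<lambda>z. (1 - t) * f z + t * g z)" for t :: real
  have "continuous_on {0..1} h"
    unfolding h_def by (intro continuous_on_coordinatewise_then_product continuous_intros)
  moreover have "h t \<in> HomK3 n E" if t: "t \<in> {0..1}" for t
    unfolding in_HomK3_iff
  proof (intro conjI allI impI)
    show "0 \<le> h t (v, i)" for v i using f g t by (simp add: h_def in_HomK3_iff)
    show "h t (v, i) = 0" if "n \<le> v \<or> 3 \<le> i" for v i using f g that by (auto simp: h_def in_HomK3_iff)
    show "h t (v, 0) + h t (v, 1) + h t (v, 2) = 1" if "v < n" for v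
    proof -
      have "h t (v, 0) + h t (v, 1) + h t (v, 2)
          = (1 - t) * (f (v, 0) + f (v, 1) + f (v, 2)) + t * (g (v, 0) + g (v, 1) + g (v, 2))"
        by (simp add: h_def algebra_simps)
      then show ?thesis using f g that by (simp add: in_HomK3_iff)
    qed
    show "h t (x, i) = 0 \<or> h t (y, i) = 0" if "{x, y} \<in> E" for x y i
      using fg[OF that, of i] by (auto simp: h_def)
  qed
  ultimately have "pathin (top_of_set (HomK3 n E)) h"
    by (auto simp: pathin_def continuous_map_subtopology_eu)
  moreover have "h 0 = f" "h 1 = g" by (auto simp: h_def)
  ultimately show ?thesis unfolding path_component_of_def by blast
qed

definition colouring_point :: "nat \<Rightarrow> (nat \<Rightarrow> nat) \<Rightarrow> nat \<times> nat \<Rightarrow> real" where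
  "colouring_point n \<phi> = (\<lambda>(v, i). if v < n \<and> i = \<phi> v then 1 else 0)"

lemma colouring_point_in:
  assumes "proper E {..<n} \<phi>"
  shows "colouring_point n \<phi> \<in> HomK3 n E"
proof -
  have c: "v < n \<Longrightarrow> \<phi> v \<in> {0, 1, 2}" for v using assms by (force simp: proper_def)
  show ?thesis unfolding in_HomK3_iff
  proof (intro conjI allI impI)
    show "colouring_point n \<phi> (v, i) = 0" if "n \<le> v \<or> 3 \<le> i" for v i
      using that c[of v] by (auto simp: colouring_point_def)
    show "colouring_point n \<phi> (v, 0) + colouring_point n \<phi> (v, 1) + colouring_point n \<phi> (v, 2) = 1" if "v < n" for v
      using that c[of v] by (auto simp: colouring_point_def)
    show "colouring_point n \<phi> (x, i) = 0 \<or> colouring_point n \<phi> (y, i) = 0" if "{x, y} \<in> E" for x y i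
    proof -
      have "\<phi> x \<noteq> \<phi> y" if "x < n" "y < n"
        using assms \<open>{x, y} \<in> E\<close> that unfolding proper_def by blast
      then show ?thesis by (auto simp: colouring_point_def)
    qed
  qed (simp add: colouring_point_def)
qed

text \<open>An arbitrarily chosen vertex of the cell that carries f; whatever is derived from it has
  to be independent of the choice.\<close>

definition support_colouring :: "(nat \<times> nat \<Rightarrow> real) \<Rightarrow> nat \<Rightarrow> nat" where
  "support_colouring f v = (SOME i. f (v, i) > 0)"

lemma support_colouring_pos:
  assumes "f \<in> HomK3 n E" "v < n"
  shows "f (v, support_colouring f v) > 0"
proof -
  have "f (v, 0) + f (v, 1) + f (v, 2) = 1" "0 \<le> f (v, 0)" "0 \<le> f (v, 1)" "0 \<le> f (v, 2)"
    using assms by (auto simp: in_HomK3_iff)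
  then have "f (v, 0) > 0 \<or> f (v, 1) > 0 \<or> f (v, 2) > 0" by linarith
  then show ?thesis unfolding support_colouring_def by (metis someI)
qed

lemma proper_if_supported:
  assumes f: "f \<in> HomK3 n E" and pos: "\<And>v. v < n \<Longrightarrow> f (v, \<phi> v) > 0"
  shows "proper E {..<n} \<phi>"
  unfolding proper_def
proof (intro conjI ballI impI)
  show "\<phi> v < 3" if "v \<in> {..<n}" for v
    using f pos[of v] that unfolding in_HomK3_iff by (metis lessThan_iff not_le order_less_irrefl)
  show "\<phi> u \<noteq> \<phi> w" if "u \<in> {..<n}" "w \<in> {..<n}" "{u, w} \<in> E" for u w
    using f pos[of u] pos[of w] that unfolding in_HomK3_iff by (metis lessThan_iff order_less_irrefl)
qed

lemma path_component_of_colouring_point: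
  assumes E: "E \<subseteq> all_pairs n" and f: "f \<in> HomK3 n E"
  shows "path_component_of (top_of_set (HomK3 n E)) f (colouring_point n (support_colouring f))"
proof (rule path_component_of_segment[OF f])
  have pos: "f (v, support_colouring f v) > 0" if "v < n" for v
    by (rule support_colouring_pos[OF f that])
  show "colouring_point n (support_colouring f) \<in> HomK3 n E"
    by (rule colouring_point_in[OF proper_if_supported[OF f pos]])
  have sup: "colouring_point n (support_colouring f) (v, i) = 0" if "f (v, i) = 0" for v i
    using that pos[of v] by (auto simp: colouring_point_def)
  show "f (x, i) = 0 \<and> colouring_point n (support_colouring f) (x, i) = 0 \<or>
      f (y, i) = 0 \<and> colouring_point n (support_colouring f) (y, i) = 0" if "{x, y} \<in> E" for x y i
  proof -
    have "f (x, i) = 0 \<or> f (y, i) = 0" using f that unfolding in_HomK3_iff by blast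
    then show ?thesis using sup by metis
  qed
qed

text \<open>Two adjacent vertices never change colour together, so both colourings lie in a common
  cell.\<close>

lemma path_component_of_recolour:
  assumes E: "E \<subseteq> all_pairs n" and r: "recolour E {..<n} \<phi> \<phi>'"
  shows "path_component_of (top_of_set (HomK3 n E)) (colouring_point n \<phi>) (colouring_point n \<phi>')"
proof (rule path_component_of_segment)
  have p: "proper E {..<n} \<phi>" "proper E {..<n} \<phi>'" using r by (auto simp: recolour_def)
  obtain v where v: "\<And>u. u \<noteq> v \<Longrightarrow> \<phi> u = \<phi>' u" using r by (auto simp: recolour_def)
  show "colouring_point n \<phi> \<in> HomK3 n E" "colouring_point n \<phi>' \<in> HomK3 n E"
    using p by (auto intro: colouring_point_in)
  show "colouring_point n \<phi> (x, i) = 0 \<and> colouring_point n \<phi>' (x, i) = 0 \<or>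
      colouring_point n \<phi> (y, i) = 0 \<and> colouring_point n \<phi>' (y, i) = 0" if xy: "{x, y} \<in> E" for x y i
  proof -
    have "{x, y} \<in> all_pairs n" using xy E by blast
    then have b: "x < n" "y < n" "x \<noteq> y" by (simp_all add: doubleton_in_all_pairs)
    then have "\<phi> x \<noteq> \<phi> y" "\<phi>' x \<noteq> \<phi>' y" using p xy by (auto simp: proper_def)
    moreover have "\<phi> x = \<phi>' x \<or> \<phi> y = \<phi>' y" using v b by metis
    ultimately show ?thesis by (auto simp: colouring_point_def)
  qed
qed

lemma loopless: "E \<subseteq> all_pairs n \<Longrightarrow> {v} \<notin> E"
  using doubleton_in_all_pairs[of v v n] by auto

lemma path_connected_HomK3:
  assumes E: "E \<subseteq> all_pairs n" and "\<not> has_bicycle E" "\<not> has_bad_cycle E"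
  shows "path_connected_space (top_of_set (HomK3 n E))"
  unfolding path_connected_space_iff_path_component
proof (intro ballI)
  let ?X = "top_of_set (HomK3 n E)"
  fix f g assume "f \<in> topspace ?X" "g \<in> topspace ?X"
  then have f: "f \<in> HomK3 n E" and g: "g \<in> HomK3 n E" by auto
  have p: "proper E {..<n} (support_colouring h)" if "h \<in> HomK3 n E" for h
    by (rule proper_if_supported[OF that support_colouring_pos[OF that]])
  obtain \<phi> where \<phi>: "(recolour E {..<n})\<^sup>*\<^sup>* (support_colouring f) \<phi>" "\<forall>v\<in>{..<n}. \<phi> v = support_colouring g v"
    using recolour_connected[OF _ loopless[OF E] assms(2,3) p[OF f] p[OF g]] by auto
  have *: "path_component_of ?X (colouring_point n (support_colouring f)) (colouring_point n \<phi>)"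
    using \<phi>(1)
  proof (induction rule: rtranclp_induct)
    case base
    then show ?case using colouring_point_in[OF p[OF f]] by (simp add: path_component_of_refl)
  next
    case (step \<psi> \<psi>')
    show ?case by (rule path_component_of_trans[OF step.IH path_component_of_recolour[OF E step(2)]])
  qed
  have eq: "colouring_point n \<phi> = colouring_point n (support_colouring g)"
    using \<phi>(2) by (auto simp: colouring_point_def fun_eq_iff)
  have "path_component_of ?X (colouring_point n \<phi>) g"
    unfolding eq by (rule path_component_of_sym[OF path_component_of_colouring_point[OF E g]])
  then show "path_component_of ?X f g"
    by (rule path_component_of_trans[OF path_component_of_trans[OF path_component_of_colouring_point[OF E f] *]])
qed


subsection \<open>Winding numbers\<close>

text \<open>The colours are the corners of an oriented triangle; for colours below 3 the value 0
  occurs only when they are equal.\<close>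

definition turn :: "nat \<Rightarrow> nat \<Rightarrow> int" where
  "turn a b = (if b = Suc a mod 3 then 1 else if a = Suc b mod 3 then - 1 else 0)"

text \<open>For a proper colouring this is three times the degree of the map from the cycle to the
  triangle.\<close>

definition winding :: "nat list \<Rightarrow> (nat \<Rightarrow> nat) \<Rightarrow> int" where
  "winding xs \<phi> = (\<Sum>t<length xs. turn (\<phi> (xs ! t)) (\<phi> (xs ! (Suc t mod length xs))))"

lemma less_3_cases: "(a::nat) < 3 \<Longrightarrow> a = 0 \<or> a = 1 \<or> a = 2"
  by auto

text \<open>Moving one end of an edge to the other admissible colour reverses its turn, a change by
  2 or -2. Written as a difference of contributions of the two ends, the change telescopes round a
  cycle.\<close>

lemma turn_shift:
  assumes "a < 3" "a' < 3" "b < 3" "b' < 3" "a \<noteq> b" "a \<noteq> b'" "a' \<noteq> b" "a' \<noteq> b'"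
  shows "turn a' b' = turn a b + 2 * turn a a' - 2 * turn b b'"
  using less_3_cases[OF assms(1)] less_3_cases[OF assms(2)] less_3_cases[OF assms(3)] less_3_cases[OF assms(4)] assms(5-8)
  by (elim disjE) (simp_all add: turn_def)

lemma sum_cyclic_shift: "(\<Sum>t<k. g (Suc t mod k)) = (\<Sum>t<k. g t :: int)"
proof (cases k)
  case (Suc m)
  have "(\<Sum>t<k. g (Suc t mod k)) = (\<Sum>t<m. g (Suc t mod k)) + g 0"
    by (simp add: Suc)
  also have "(\<Sum>t<m. g (Suc t mod k)) = (\<Sum>t<m. g (Suc t))"
    by (intro sum.cong) (auto simp: Suc)
  also have "\<dots> + g 0 = (\<Sum>t<k. g t)"
    unfolding Suc by (simp only: sum.lessThan_Suc_shift add.commute)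
  finally show ?thesis .
qed simp

text \<open>By \<open>turn_shift\<close> the two winding numbers differ by a sum that telescopes
  cyclically.\<close>

lemma winding_eq_if_same_cell:
  assumes xs: "cyc_edges xs \<subseteq> E"
    and lt: "\<And>v. v \<in> set xs \<Longrightarrow> \<phi> v < 3 \<and> \<psi> v < 3"
    and ne: "\<And>u w. {u, w} \<in> E \<Longrightarrow> u \<in> set xs \<Longrightarrow> w \<in> set xs \<Longrightarrow> {\<phi> u, \<psi> u} \<inter> {\<phi> w, \<psi> w} = {}"
  shows "winding xs \<phi> = winding xs \<psi>"
proof -
  let ?k = "length xs"
  define g where "g t = 2 * turn (\<phi> (xs ! t)) (\<psi> (xs ! t))" for t
  have "winding xs \<psi> = (\<Sum>t<?k. turn (\<phi> (xs ! t)) (\<phi> (xs ! (Suc t mod ?k))) + (g t - g (Suc t mod ?k)))"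
    unfolding winding_def
  proof (rule sum.cong[OF refl])
    fix t assume t: "t \<in> {..<?k}"
    let ?u = "xs ! t" and ?w = "xs ! (Suc t mod ?k)"
    have "Suc t mod ?k < ?k" using t by (intro mod_less_divisor) auto
    then have uw: "?u \<in> set xs" "?w \<in> set xs" using t by auto
    have "{?u, ?w} \<in> E" using xs t by (auto simp: cyc_edges_def)
    from ne[OF this uw] have "turn (\<psi> ?u) (\<psi> ?w) = turn (\<phi> ?u) (\<phi> ?w) + 2 * turn (\<phi> ?u) (\<psi> ?u) - 2 * turn (\<phi> ?w) (\<psi> ?w)"
      using lt uw by (intro turn_shift) auto
    then show "turn (\<psi> ?u) (\<psi> ?w) = turn (\<phi> ?u) (\<phi> ?w) + (g t - g (Suc t mod ?k))"
      by (simp add: g_def)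
  qed
  also have "\<dots> = winding xs \<phi> + ((\<Sum>t<?k. g t) - (\<Sum>t<?k. g (Suc t mod ?k)))"
    by (simp add: winding_def sum.distrib sum_subtractf)
  finally show ?thesis by (simp add: sum_cyclic_shift)
qed

lemma winding_supported:
  assumes f: "f \<in> HomK3 n E" and xs: "cyc_edges xs \<subseteq> E" "set xs \<subseteq> {..<n}"
    and pos: "\<And>v. v < n \<Longrightarrow> f (v, \<phi> v) > 0" "\<And>v. v < n \<Longrightarrow> f (v, \<psi> v) > 0"
  shows "winding xs \<phi> = winding xs \<psi>"
proof (rule winding_eq_if_same_cell[OF xs(1)])
  fix v assume "v \<in> set xs"
  then have "v \<in> {..<n}" using xs by blast
  then show "\<phi> v < 3 \<and> \<psi> v < 3"
    using proper_if_supported[OF f pos(1)] proper_if_supported[OF f pos(2)] unfolding proper_def by blast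
next
  fix u w assume uw: "{u, w} \<in> E" "u \<in> set xs" "w \<in> set xs"
  then have "u < n" "w < n" using xs by auto
  then have "0 < f (u, i) \<and> 0 < f (w, j)" if "i \<in> {\<phi> u, \<psi> u}" "j \<in> {\<phi> w, \<psi> w}" for i j
    using pos that by auto
  moreover have "\<not> (0 < f (u, i) \<and> 0 < f (w, i))" for i
    using f uw(1) unfolding in_HomK3_iff by (metis order_less_irrefl)
  ultimately show "{\<phi> u, \<psi> u} \<inter> {\<phi> w, \<psi> w} = {}" by blast
qed

text \<open>The colours chosen at f keep positive weight at all nearby points g. There both the
  colouring chosen at f and the one chosen at g are supported by g, so their winding numbers
  agree.\<close>

lemma winding_constant_on:
  assumes conn: "connected (HomK3 n E)" and xs: "cyc_edges xs \<subseteq> E" "set xs \<subseteq> {..<n}"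
  shows "(\<lambda>f. winding xs (support_colouring f)) constant_on HomK3 n E"
proof (rule locally_constant_imp_constant[OF conn])
  fix f assume f: "f \<in> HomK3 n E"
  define U where "U = (\<Inter>v\<in>{..<n}. {g :: nat \<times> nat \<Rightarrow> real. 0 < g (v, support_colouring f v)})"
  have "open {g :: nat \<times> nat \<Rightarrow> real. 0 < g z}" for z
    by (intro open_Collect_less continuous_intros continuous_on_product_coordinates)
  then have "open U" unfolding U_def by (intro open_INT) auto
  then have "openin (top_of_set (HomK3 n E)) (HomK3 n E \<inter> U)" by (rule openin_open_Int)
  moreover have "f \<in> HomK3 n E \<inter> U" using f by (auto simp: U_def support_colouring_pos)
  moreover have "winding xs (support_colouring g) = winding xs (support_colouring f)" if gU: "g \<in> HomK3 n E \<inter> U" for g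
  proof (rule winding_supported[OF _ xs])
    show g: "g \<in> HomK3 n E" using gU by simp
    show "g (v, support_colouring g v) > 0" if "v < n" for v by (rule support_colouring_pos[OF g that])
    show "g (v, support_colouring f v) > 0" if "v < n" for v using that gU by (auto simp: U_def)
  qed
  ultimately show "\<exists>T. openin (top_of_set (HomK3 n E)) T \<and> f \<in> T \<and>
      (\<forall>g\<in>T. winding xs (support_colouring g) = winding xs (support_colouring f))" by blast
qed

lemma support_colouring_colouring_point:
  "v < n \<Longrightarrow> support_colouring (colouring_point n \<phi>) v = \<phi> v"
  unfolding support_colouring_def colouring_point_def by (rule some_equality) (auto split: if_splits)

text \<open>If 3 divides k, the walk runs round the triangle in one direction. Otherwise a walk
  shorter by two is padded with a step forward and back, whose turns cancel. The recursion would
  meet the forbidden length 4 only from 6, which the first case covers.\<close>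

lemma closed_walk_colouring:
  "3 \<le> k \<Longrightarrow> k \<noteq> 4 \<Longrightarrow> \<exists>c :: nat \<Rightarrow> nat. (\<forall>t. c t < 3) \<and> (\<forall>t<k. c t \<noteq> c (Suc t)) \<and> c k = c 0 \<and>
    (\<Sum>t<k. turn (c t) (c (Suc t))) \<noteq> 0"
proof (induction k rule: less_induct)
  case (less k)
  have "k = 3 \<or> k = 6 \<or> 5 \<le> k \<and> k \<noteq> 6" using less.prems by linarith
  then consider "k mod 3 = 0" | "5 \<le> k" "k \<noteq> 6" by auto
  then show ?case
  proof cases
    case 1
    have "turn (t mod 3) (Suc t mod 3) = 1" for t by (simp add: turn_def mod_Suc_eq)
    then have "(\<Sum>t<k. turn (t mod 3) (Suc t mod 3)) \<noteq> 0" using less.prems by simp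
    moreover have "t mod 3 \<noteq> Suc t mod 3" for t :: nat by presburger
    ultimately show ?thesis using 1 by (intro exI[of _ "\<lambda>t. t mod 3"]) simp
  next
    case 2
    define m where "m = k - 2"
    have k: "k = Suc (Suc m)" using 2 by (simp add: m_def)
    have "m < k" "3 \<le> m" "m \<noteq> 4" using 2 by (auto simp: m_def)
    from less.IH[OF this] obtain c where c: "\<And>t. c t < 3" "\<And>t. t < m \<Longrightarrow> c t \<noteq> c (Suc t)" "c m = c 0"
      "(\<Sum>t<m. turn (c t) (c (Suc t))) \<noteq> 0" by blast
    \<comment> \<open>Appends to the closed walk an excursion from its final colour to the next one
      and back.\<close>
    define d where "d t = (if t \<le> m then c t else if t = Suc m then Suc (c m) mod 3 else c m)" for t
    have ne: "Suc a mod 3 \<noteq> a" if "a < 3" for a using less_3_cases[OF that] by auto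
    have "\<forall>t. d t < 3" using c(1) by (auto simp: d_def)
    moreover have "\<forall>t<k. d t \<noteq> d (Suc t)"
      using c(2) ne[OF c(1), of m] by (auto simp: d_def k less_Suc_eq)
    moreover have "d k = d 0" using c(3) by (simp add: d_def k)
    moreover have "(\<Sum>t<k. turn (d t) (d (Suc t))) = (\<Sum>t<m. turn (d t) (d (Suc t)))"
    proof -
      have "turn a (Suc a mod 3) + turn (Suc a mod 3) a = 0" if "a < 3" for a
        using less_3_cases[OF that] by (elim disjE) (simp_all add: turn_def)
      moreover have "d m = c m" "d (Suc m) = Suc (c m) mod 3" "d (Suc (Suc m)) = c m" by (simp_all add: d_def)
      ultimately show ?thesis using c(1)[of m] by (simp add: k)
    qed
    moreover have "(\<Sum>t<m. turn (d t) (d (Suc t))) = (\<Sum>t<m. turn (c t) (c (Suc t)))"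
      by (intro sum.cong) (auto simp: d_def)
    ultimately show ?thesis using c(4) by (intro exI[of _ d]) simp
  qed
qed

text \<open>Exchanging two colours reverses the winding number.\<close>

lemma not_connected_HomK3:
  assumes E: "E \<subseteq> all_pairs n" and "\<not> has_bicycle E" "has_bad_cycle E"
  shows "HomK3 n E \<noteq> {}" and "\<not> connected (HomK3 n E)"
proof -
  obtain xs where xs: "distinct xs" "2 < length xs" "length xs \<noteq> 4" "cyc_edges xs \<subseteq> E"
    using assms(3) by (auto simp: has_bad_cycle_def)
  let ?k = "length xs"
  have sub: "set xs \<subseteq> {..<n}"
    using xs E Union_cyc_edges[of xs] by (fastforce simp: all_pairs_eq)
  obtain c where c: "\<And>t. c t < (3::nat)" "\<And>t. t < ?k \<Longrightarrow> c t \<noteq> c (Suc t)" "c ?k = c 0"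
    "(\<Sum>t<?k. turn (c t) (c (Suc t))) \<noteq> 0"
    using closed_walk_colouring[of ?k] xs by auto
  have cmod: "c (Suc t mod ?k) = c (Suc t)" if "t < ?k" for t
    using that c(3) by (auto simp: Suc_mod_eq)
  \<comment> \<open>Transports the colours from positions to vertices. Off the cycle
    \<open>inv_into\<close> gives an unspecified index, but every \<open>c t\<close> is below 3, so
    the bound on colours holds everywhere.\<close>
  define \<theta> where "\<theta> v = c (inv_into {..<?k} ((!) xs) v)" for v
  have \<theta>: "\<theta> (xs ! t) = c t" if "t < ?k" for t
    using that xs(1) by (simp add: \<theta>_def inv_into_f_f inj_on_nth)
  have m: "Suc t mod ?k < ?k" if "t < ?k" for t using that by (intro mod_less_divisor) linarith
  have "\<exists>\<phi>. proper E {..<n} \<phi> \<and> (\<forall>w\<in>set xs. \<phi> w = \<theta> w)"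
    by (rule extend_colouring_of_cycle[OF xs(1,2,4) loopless[OF E] assms(2)])
      (use c(1,2) sub in \<open>auto simp: \<theta> m cmod\<close>, simp add: \<theta>_def c(1))
  then obtain \<phi> where \<phi>: "proper E {..<n} \<phi>" "\<And>w. w \<in> set xs \<Longrightarrow> \<phi> w = \<theta> w" by blast
  then show "HomK3 n E \<noteq> {}" using colouring_point_in by blast
  define \<psi> where "\<psi> v = (if \<phi> v = 1 then 2 else if \<phi> v = 2 then 1 else \<phi> v)" for v
  have \<psi>: "proper E {..<n} \<psi>"
    unfolding proper_def
  proof (intro conjI ballI impI)
    show "\<psi> v < 3" if "v \<in> {..<n}" for v using \<phi>(1) that by (auto simp: proper_def \<psi>_def)
    show "\<psi> u \<noteq> \<psi> w" if "u \<in> {..<n}" "w \<in> {..<n}" "{u, w} \<in> E" for u w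
    proof -
      have "\<phi> u \<noteq> \<phi> w" using \<phi>(1) that unfolding proper_def by blast
      then show ?thesis by (auto simp: \<psi>_def)
    qed
  qed
  have w: "winding xs \<phi> \<noteq> 0"
  proof -
    have "winding xs \<phi> = (\<Sum>t<?k. turn (c t) (c (Suc t)))"
      unfolding winding_def by (intro sum.cong) (auto simp: \<phi>(2) \<theta> m cmod)
    then show ?thesis using c(4) by simp
  qed
  have swap: "winding xs \<psi> = - winding xs \<phi>"
    unfolding winding_def sum_negf[symmetric]
  proof (rule sum.cong[OF refl])
    fix t assume t: "t \<in> {..<?k}"
    let ?u = "xs ! t" and ?w = "xs ! (Suc t mod ?k)"
    have "?u \<in> {..<n}" "?w \<in> {..<n}" using t m sub nth_mem[of _ xs] by blast+
    then have "\<phi> ?u < 3" "\<phi> ?w < 3" using \<phi>(1) by (auto simp: proper_def)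
    from less_3_cases[OF this(1)] less_3_cases[OF this(2)]
    show "turn (\<psi> ?u) (\<psi> ?w) = - turn (\<phi> ?u) (\<phi> ?w)"
      by (elim disjE) (simp_all add: \<psi>_def turn_def)
  qed
  have pt: "winding xs (support_colouring (colouring_point n \<xi>)) = winding xs \<xi>" for \<xi>
    unfolding winding_def
  proof (rule sum.cong[OF refl])
    fix t assume t: "t \<in> {..<?k}"
    have "xs ! t \<in> {..<n}" "xs ! (Suc t mod ?k) \<in> {..<n}" using t m sub nth_mem[of _ xs] by blast+
    then show "turn (support_colouring (colouring_point n \<xi>) (xs ! t)) (support_colouring (colouring_point n \<xi>) (xs ! (Suc t mod ?k)))
        = turn (\<xi> (xs ! t)) (\<xi> (xs ! (Suc t mod ?k)))"
      by (simp add: support_colouring_colouring_point)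
  qed
  show "\<not> connected (HomK3 n E)"
  proof
    assume "connected (HomK3 n E)"
    from winding_constant_on[OF this xs(4) sub] obtain y where
      y: "\<And>f. f \<in> HomK3 n E \<Longrightarrow> winding xs (support_colouring f) = y"
      unfolding constant_on_def by blast
    have "winding xs \<phi> = winding xs \<psi>"
      using y[OF colouring_point_in[OF \<phi>(1)]] y[OF colouring_point_in[OF \<psi>]] by (simp only: pt)
    then show False using swap w by simp
  qed
qed

subsection \<open>A homotopically nontrivial loop\<close>

text \<open>Identifies the complex plane with the plane of triples of sum zero by means of the first
  two coordinates.\<close>

definition circle_coord :: "complex \<Rightarrow> nat \<Rightarrow> real" where
  "circle_coord z i = (if i = 0 then Re z else if i = 1 then Im z else if i = 2 then - (Re z + Im z) else 0)"

text \<open>Half of the l1-norm of the triple of coordinates.\<close>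

definition circle_mass :: "complex \<Rightarrow> real" where
  "circle_mass z = max 0 (circle_coord z 0) + max 0 (circle_coord z 1) + max 0 (circle_coord z 2)"

text \<open>For a bipartite graph and the two sides given by \<open>s\<close>, the positive part of a point of the hexagon
  \<open>t\<^sub>0 + t\<^sub>1 + t\<^sub>2 = 0\<close> is put on one side and the negative part on the other.\<close>

definition circle_lift :: "nat \<Rightarrow> (nat \<Rightarrow> bool) \<Rightarrow> complex \<Rightarrow> nat \<times> nat \<Rightarrow> real" where
  "circle_lift n s z = (\<lambda>(v, i). if v < n then max 0 (if s v then circle_coord z i else - circle_coord z i) / circle_mass z else 0)"

text \<open>The difference of the distributions at u and w is a triple of sum zero, read off in its
  first two coordinates and normalised to the unit circle.\<close>

definition circle_proj :: "nat \<Rightarrow> nat \<Rightarrow> (nat \<times> nat \<Rightarrow> real) \<Rightarrow> complex" where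
  "circle_proj u w f = sgn (Complex (f (u, 0) - f (w, 0)) (f (u, 1) - f (w, 1)))"

lemma circle_mass_pos: "z \<noteq> 0 \<Longrightarrow> 0 < circle_mass z"
  by (auto simp: circle_mass_def circle_coord_def complex_eq_iff max_def)

text \<open>The coordinates have sum zero, so their positive and negative parts have equal mass; one
  normalising factor thus serves both sides of the bipartition.\<close>

lemma circle_mass_minus:
  "max 0 (- circle_coord z 0) + max 0 (- circle_coord z 1) + max 0 (- circle_coord z 2) = circle_mass z"
  by (auto simp: circle_mass_def circle_coord_def max_def)

lemma circle_lift_in:
  assumes "z \<noteq> 0" and s: "\<And>u w. {u, w} \<in> E \<Longrightarrow> s u \<noteq> s w"
  shows "circle_lift n s z \<in> HomK3 n E"
  unfolding in_HomK3_iff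
proof (intro conjI allI impI)
  have m: "0 < circle_mass z" using assms(1) by (rule circle_mass_pos)
  show "0 \<le> circle_lift n s z (v, i)" for v i using m by (auto simp: circle_lift_def)
  show "circle_lift n s z (v, i) = 0" if "n \<le> v \<or> 3 \<le> i" for v i
    using that by (auto simp: circle_lift_def circle_coord_def)
  show "circle_lift n s z (v, 0) + circle_lift n s z (v, 1) + circle_lift n s z (v, 2) = 1" if "v < n" for v
    using that m circle_mass_minus[of z] circle_mass_def[of z]
    by (cases "s v") (simp_all add: circle_lift_def add_divide_distrib[symmetric])
  show "circle_lift n s z (x, i) = 0 \<or> circle_lift n s z (y, i) = 0" if "{x, y} \<in> E" for x y i
    using s[OF that] by (auto simp: circle_lift_def max_def)
qed

lemma circle_proj_lift:
  assumes "norm z = 1" "u < n" "w < n" "s u" "\<not> s w"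
  shows "circle_proj u w (circle_lift n s z) = z"
proof -
  have m: "0 < circle_mass z" using assms(1) by (intro circle_mass_pos) auto
  \<comment> \<open>The positive part minus the negative part of a number is the number
    itself.\<close>
  have d: "circle_lift n s z (u, i) - circle_lift n s z (w, i) = circle_coord z i / circle_mass z" for i
    using assms by (auto simp: circle_lift_def diff_divide_distrib[symmetric] max_def)
  have "Complex (Re z / circle_mass z) (Im z / circle_mass z) = (1 / circle_mass z) *\<^sub>R z"
    by (simp add: complex_eq_iff)
  then have "circle_proj u w (circle_lift n s z) = sgn ((1 / circle_mass z) *\<^sub>R z)"
    unfolding circle_proj_def d by (simp add: circle_coord_def)
  also have "\<dots> = sgn z" using m by (simp add: sgn_scaleR)
  also have "\<dots> = z" using assms(1) by (simp add: sgn_div_norm)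
  finally show ?thesis .
qed

text \<open>Colours 0 and 1 with equal weights at u and w must have weight 0, as the supports are
  disjoint; then both vertices carry colour 2 with weight 1, a contradiction.\<close>

lemma circle_proj_nonzero:
  assumes "f \<in> HomK3 n E" "{u, w} \<in> E" "u < n" "w < n"
  shows "Complex (f (u, 0) - f (w, 0)) (f (u, 1) - f (w, 1)) \<noteq> 0"
proof
  assume "Complex (f (u, 0) - f (w, 0)) (f (u, 1) - f (w, 1)) = 0"
  then have "f (u, 0) = f (w, 0)" "f (u, 1) = f (w, 1)" by (auto simp: complex_eq_iff)
  moreover have "f (u, i) = 0 \<or> f (w, i) = 0" for i using assms unfolding in_HomK3_iff by blast
  moreover have "f (u, 0) + f (u, 1) + f (u, 2) = 1" "f (w, 0) + f (w, 1) + f (w, 2) = 1"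
    using assms unfolding in_HomK3_iff by auto
  ultimately show False by (metis add.left_neutral zero_neq_one)
qed

lemma continuous_on_circle_proj:
  assumes "{u, w} \<in> E" "u < n" "w < n"
  shows "continuous_on (HomK3 n E) (circle_proj u w)"
  unfolding circle_proj_def
  by (intro continuous_on_sgn continuous_on_Complex continuous_on_diff ballI
      continuous_on_subset[OF continuous_on_product_coordinates] subset_UNIV)
    (use circle_proj_nonzero[OF _ assms] in blast)

lemma continuous_on_circle_lift: "continuous_on (- {0}) (circle_lift n s)"
proof (rule continuous_on_coordinatewise_then_product)
  fix x :: "nat \<times> nat"
  obtain v i where x: "x = (v, i)" by (cases x)
  have coord: "continuous_on (- {0}) (\<lambda>z. circle_coord z j)" for j
    unfolding circle_coord_def by (cases "j = 0"; cases "j = 1"; cases "j = 2") (auto intro!: continuous_intros)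
  have mass: "continuous_on (- {0}) circle_mass"
    unfolding circle_mass_def by (intro continuous_intros coord)
  have "continuous_on (- {0}) (\<lambda>z. if s v then circle_coord z i else - circle_coord z i)"
    by (cases "s v") (auto intro!: continuous_intros coord)
  then show "continuous_on (- {0}) (\<lambda>z. circle_lift n s z x)"
    unfolding circle_lift_def x using circle_mass_pos
    by (cases "v < n") (auto intro!: continuous_intros mass simp: less_imp_neq[symmetric] dest: order_less_imp_not_eq2)
qed

text \<open>On the unit circle the projection undoes the lift. A loop in the circle is lifted to
  Hom, contracted there, and the contraction projected back, which would make the circle simply
  connected.\<close>

lemma not_simply_connected_HomK3:
  fixes s :: "nat \<Rightarrow> bool"
  assumes E: "E \<subseteq> all_pairs n" "E \<noteq> {}" and s: "\<And>u w. {u, w} \<in> E \<Longrightarrow> s u \<noteq> s w"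
  shows "\<not> simply_connected_space (top_of_set (HomK3 n E))"
proof
  assume sc: "simply_connected_space (top_of_set (HomK3 n E))"
  obtain e where "e \<in> E" "e \<in> all_pairs n" using E by blast
  then obtain a b where ab: "{a, b} \<in> E" "a < n" "b < n" by (auto simp: all_pairs_def)
  \<comment> \<open>The lift puts the positive part where s holds, so the edge is oriented with s
    true at u; the other orientation would yield the antipodal map.\<close>
  obtain u w where uw: "{u, w} \<in> E" "u < n" "w < n" "s u" "\<not> s w"
  proof (cases "s a")
    case True
    then show thesis using that[of a b] s[OF ab(1)] ab by blast
  next
    case False
    have "{b, a} \<in> E" using ab(1) by (simp add: insert_commute)
    then show thesis using that[of b a] s[OF ab(1)] ab False by blast
  qed
  let ?S = "sphere (0::complex) 1"
  have proj: "continuous_map (top_of_set (HomK3 n E)) (top_of_set ?S) (circle_proj u w)"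
    using continuous_on_circle_proj[OF uw(1-3)] circle_proj_nonzero[OF _ uw(1-3)]
    by (auto simp: continuous_map_subtopology_eu circle_proj_def norm_sgn)
  have "simply_connected ?S"
    unfolding simply_connected_eq_contractible_loop_some
  proof (intro conjI allI impI)
    show "path_connected ?S" by (rule path_connected_sphere) simp
    fix q :: "real \<Rightarrow> complex" assume q: "path q \<and> path_image q \<subseteq> ?S \<and> pathfinish q = pathstart q"
    define p where "p = circle_lift n s \<circ> q"
    have qS: "norm (q t) = 1" if "t \<in> {0..1}" for t
    proof -
      have "q t \<in> ?S" using q that unfolding path_image_def by blast
      then show ?thesis by simp
    qed
    then have q0: "q t \<noteq> 0" if "t \<in> {0..1}" for t using that by fastforce
    have "continuous_on {0..1} p"
      unfolding p_def using q q0 by (intro continuous_on_compose continuous_on_subset[OF continuous_on_circle_lift]) (auto simp: path_def)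
    moreover have "p t \<in> HomK3 n E" if "t \<in> {0..1}" for t
      unfolding p_def o_def using q0[OF that] s by (rule circle_lift_in)
    ultimately have "pathin (top_of_set (HomK3 n E)) p"
      by (auto simp: pathin_def continuous_map_subtopology_eu)
    moreover have "p 1 = p 0" using q by (simp add: p_def pathfinish_def pathstart_def)
    ultimately have "homotopic_with (\<lambda>r. r 1 = r 0) (top_of_set {0..1}) (top_of_set (HomK3 n E)) p (\<lambda>_. p 0)"
      using sc by (auto simp: simply_connected_space_def)
    then have "homotopic_with (\<lambda>r. r 1 = r 0) (top_of_set {0..1}) (top_of_set ?S) (circle_proj u w \<circ> p) (circle_proj u w \<circ> (\<lambda>_. p 0))"
      by (rule homotopic_with_compose_continuous_map_left[OF _ proj]) simp
    moreover have inv: "(circle_proj u w \<circ> p) t = q t" if "t \<in> {0..1}" for t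
      unfolding p_def o_def by (rule circle_proj_lift[OF qS[OF that] uw(2-5)])
    \<comment> \<open>As functions on the whole line q and the composite may differ outside the unit
      interval, so they are joined by a trivial homotopy instead of being identified.\<close>
    moreover have "homotopic_with (\<lambda>r. r 1 = r 0) (top_of_set {0..1}) (top_of_set ?S) q (circle_proj u w \<circ> p)"
      by (rule homotopic_with_equal)
        (use q inv in \<open>auto simp: continuous_map_subtopology_eu path_def path_image_def pathfinish_def pathstart_def image_subset_iff\<close>)
    ultimately have "homotopic_with (\<lambda>r. r 1 = r 0) (top_of_set {0..1}) (top_of_set ?S) q (circle_proj u w \<circ> (\<lambda>_. p 0))"
      using homotopic_with_trans by blast
    moreover have "circle_proj u w \<circ> (\<lambda>_. p 0) = linepath (q 0) (q 0)"
      using inv[of 0] by (auto simp: fun_eq_iff linepath_refl)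
    ultimately have "homotopic_loops ?S q (linepath (q 0) (q 0))"
      by (simp add: homotopic_loops_def pathfinish_def pathstart_def)
    moreover have "q 0 \<in> ?S" using qS[of 0] by simp
    ultimately show "\<exists>a. a \<in> ?S \<and> homotopic_loops ?S q (linepath a a)" by blast
  qed
  then show False using not_simply_connected_circle[of 1 0] by simp
qed

section \<open>The limit law\<close>

lemma conn_eq_0_HomK3:
  assumes E: "E \<subseteq> all_pairs n" "E \<noteq> {}" and "\<not> has_bicycle E" "\<not> has_bad_cycle E"
  shows "conn_eq_0 (hom_top n E K3_V K3_E)"
proof -
  obtain s :: "nat \<Rightarrow> bool" where "\<forall>u\<in>{..<n}. \<forall>w\<in>{..<n}. {u, w} \<in> E \<longrightarrow> s u \<noteq> s w"
    using bipartite_if_no_bad_cycle[OF _ loopless[OF E(1)] assms(3,4), of "{..<n}"] by auto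
  then have s: "s u \<noteq> s w" if "{u, w} \<in> E" for u w
  proof -
    have "{u, w} \<in> all_pairs n" using that E by blast
    then show ?thesis using that \<open>\<forall>u\<in>_. _\<close> by (simp add: doubleton_in_all_pairs)
  qed
  have "HomK3 n E \<noteq> {}" using circle_lift_in[of 1 E s n] s by auto
  then show ?thesis
    using path_connected_HomK3[OF E(1) assms(3,4)] not_simply_connected_HomK3[OF E s]
    by (simp add: conn_eq_0_def hom_top_K3)
qed

lemma conn_eq_minus1_HomK3:
  assumes "E \<subseteq> all_pairs n" "\<not> has_bicycle E" "has_bad_cycle E"
  shows "conn_eq_minus1 (hom_top n E K3_V K3_E)"
proof -
  have "\<not> path_connected_space (top_of_set (HomK3 n E))"
  proof
    assume "path_connected_space (top_of_set (HomK3 n E))"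
    then have "connectedin euclidean (HomK3 n E)"
      unfolding connectedin_def by (intro conjI path_connected_imp_connected_space) auto
    then show False using not_connected_HomK3(2)[OF assms] by simp
  qed
  then show ?thesis
    using not_connected_HomK3(1)[OF assms] by (simp add: conn_eq_minus1_def hom_top_K3)
qed

text \<open>Serves all four comparisons in the final sandwich arguments; those with only two
  covering events are padded with \<open>False\<close>.\<close>

lemma gnp_prob_mono3:
  assumes "0 \<le> p" "p \<le> 1" "\<And>E. E \<subseteq> all_pairs n \<Longrightarrow> A E \<Longrightarrow> B E \<or> C E \<or> D E"
  shows "gnp_prob n p A \<le> gnp_prob n p B + gnp_prob n p C + gnp_prob n p D"
  unfolding gnp_prob_eq_bexp bexp_add[symmetric]
  using assms by (intro bexp_mono) (auto simp: of_bool_def)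

lemma gnp_prob_not: "gnp_prob n p (\<lambda>E. \<not> A E) = 1 - gnp_prob n p A"
proof -
  have "gnp_prob n p (\<lambda>E. \<not> A E) = bexp (all_pairs n) p (\<lambda>E. 1 - of_bool (A E))"
    unfolding gnp_prob_eq_bexp by (intro bexp_cong) auto
  then show ?thesis by (simp add: bexp_diff bexp_const gnp_prob_eq_bexp)
qed

theorem theorem5p4:
  fixes c c' :: real
  assumes "0 < c" "c < 1"
    and "c' = (1/2) * ln (1 - c) + c/2 + c^2/4 + c^4/8"
  shows "((\<lambda>n. gnp_prob n (c / real n) (\<lambda>E. conn_eq_minus1 (hom_top n E K3_V K3_E)))
           \<longlonglongrightarrow> 1 - exp c') \<and>
         ((\<lambda>n. gnp_prob n (c / real n) (\<lambda>E. conn_eq_0 (hom_top n E K3_V K3_E)))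
           \<longlonglongrightarrow> exp c')"
proof
  note c = assms(1,2)
  define N where "N n = gnp_prob n (c / real n) (\<lambda>E. \<not> has_bad_cycle E)" for n
  define B where "B n = gnp_prob n (c / real n) has_bicycle" for n
  define Z where "Z n = gnp_prob n (c / real n) (\<lambda>E. E = {})" for n
  have N: "N \<longlonglongrightarrow> exp c'"
    unfolding N_def assms(3) by (rule gnp_prob_no_bad_cycle_tendsto[OF c])
  have B: "B \<longlonglongrightarrow> 0" unfolding B_def by (rule gnp_prob_bicycle_tendsto_0[OF c])
  have Z: "Z \<longlonglongrightarrow> 0" unfolding Z_def by (rule gnp_prob_empty_tendsto_0[OF c])
  have bad: "gnp_prob n (c / real n) has_bad_cycle = 1 - N n" for n
    unfolding N_def gnp_prob_not by simp
  have zero: "gnp_prob n p (\<lambda>E. False) = 0" for n p by (simp add: gnp_prob_def)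
  \<comment> \<open>The lemmas on \<open>conn_eq_0\<close> and \<open>conn_eq_minus1\<close> are
    one-way implications. As the two outcomes exclude each other, each lemma also bounds the
    probability of the other outcome from above, up to the negligible events.\<close>
  have excl: "\<not> conn_eq_minus1 X" if "conn_eq_0 X" for X :: "(nat \<times> nat \<Rightarrow> real) topology"
    using that by (simp add: conn_eq_0_def conn_eq_minus1_def)
  note * = conn_eq_0_HomK3 conn_eq_minus1_HomK3
  have p: "\<forall>\<^sub>F n in sequentially. 0 \<le> c / real n \<and> c / real n \<le> 1"
    using eventually_gt_at_top[of 0]
  proof eventually_elim
    case (elim n)
    then have "1 \<le> real n" by simp
    then show ?case using c by (simp add: divide_le_eq)
  qed
  let ?m = "\<lambda>n. gnp_prob n (c / real n) (\<lambda>E. conn_eq_minus1 (hom_top n E K3_V K3_E))"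
  let ?z = "\<lambda>n. gnp_prob n (c / real n) (\<lambda>E. conn_eq_0 (hom_top n E K3_V K3_E))"
  show "?m \<longlonglongrightarrow> 1 - exp c'"
  proof (rule tendsto_sandwich)
    show "\<forall>\<^sub>F n in sequentially. 1 - N n - B n \<le> ?m n"
      using p
    proof eventually_elim
      case (elim n)
      have "gnp_prob n (c / n) has_bad_cycle \<le> ?m n + gnp_prob n (c / n) has_bicycle + gnp_prob n (c / n) (\<lambda>E. False)"
        using elim *(2) by (intro gnp_prob_mono3) auto
      then show ?case by (simp add: bad B_def zero)
    qed
    show "\<forall>\<^sub>F n in sequentially. ?m n \<le> 1 - N n + B n + Z n"
      using p
    proof eventually_elim
      case (elim n)
      have "?m n \<le> gnp_prob n (c / n) has_bad_cycle + gnp_prob n (c / n) has_bicycle + gnp_prob n (c / n) (\<lambda>E. E = {})"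
        using elim *(1) excl by (intro gnp_prob_mono3) blast+
      then show ?case by (simp add: bad B_def Z_def)
    qed
    show "(\<lambda>n. 1 - N n - B n) \<longlonglongrightarrow> 1 - exp c'"
      using tendsto_diff[OF tendsto_diff[OF tendsto_const[of 1] N] B] by simp
    show "(\<lambda>n. 1 - N n + B n + Z n) \<longlonglongrightarrow> 1 - exp c'"
      using tendsto_add[OF tendsto_add[OF tendsto_diff[OF tendsto_const[of 1] N] B] Z] by simp
  qed
  show "?z \<longlonglongrightarrow> exp c'"
  proof (rule tendsto_sandwich)
    show "\<forall>\<^sub>F n in sequentially. N n - B n - Z n \<le> ?z n"
      using p
    proof eventually_elim
      case (elim n)
      have "N n \<le> ?z n + gnp_prob n (c / n) has_bicycle + gnp_prob n (c / n) (\<lambda>E. E = {})"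
        unfolding N_def using elim *(1) by (intro gnp_prob_mono3) blast+
      then show ?case by (simp add: B_def Z_def)
    qed
    show "\<forall>\<^sub>F n in sequentially. ?z n \<le> N n + B n"
      using p
    proof eventually_elim
      case (elim n)
      have "?z n \<le> N n + gnp_prob n (c / n) has_bicycle + gnp_prob n (c / n) (\<lambda>E. False)"
        unfolding N_def using elim *(2) excl by (intro gnp_prob_mono3) blast+
      then show ?case by (simp add: B_def zero)
    qed
    show "(\<lambda>n. N n - B n - Z n) \<longlonglongrightarrow> exp c'"
      using tendsto_diff[OF tendsto_diff[OF N B] Z] by simp
    show "(\<lambda>n. N n + B n) \<longlonglongrightarrow> exp c'"
      using tendsto_add[OF N B] by simp
  qed
qed

end
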